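(* Let $L \subseteq \mathbb{R}^n$ be an $n$-dimensional lattice and let $c \in \mathbb{R}^n$ be a deep hole of $L$. Suppose that, up to equivalence by the affine isometry group of $L$, $c$ is the only deep hole of $L$ (that is, every deep hole of $L$ is the image of $c$ under some affine isometry of $\mathbb{R}^n$ mapping $L$ onto itself). Suppose further that every non-empty inhomogeneous shell $L(c,r) = \{x \in L : \|x-c\| = r\}$ around $c$ is a spherical $2$-design. Then $c$ is a stable cold spot of $L$; that is, there exists a finite $\alpha_0$ such that for every $\alpha \geq \alpha_0$ the point $c$ is a minimizer of the function $z \mapsto \sum_{x \in L} e^{-\alpha\|x-z\|^2}$ over $\mathbb{R}^n$.
   Context: A deep hole of $L$ is a point $c \in \mathbb{R}^n$ with $\min_{x\in L}\|x-c\| = \max_{z \in \mathbb{R}^n}\min_{x \in L}\|x-z\|$. A finite non-empty set $X$ on the sphere $\{x \in \mathbb{R}^n : \|x-z\| = r\}$ is a spherical $M$-design if for every polynomial $q$ on $\mathbb{R}^n$ of total degree at most $M$ one has $\int_{S^{n-1}(0,r)} q(y)\, d\omega(y) = \frac{1}{|X|}\sum_{x \in X} q(x-z)$, where $S^{n-1}(0,r)$ is the sphere of radius $r$ centered at $0$ and $\omega$ is the rotationally invariant probability measure on it. *)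

theory Defs
  imports "HOL-Analysis.Analysis" "HOL-Probability.Probability_Measure"
begin

section \<open>The rotation-invariant probability measure on a sphere\<close>

text \<open>Rotation invariance is invariance under the full orthogonal group: in dimension one the
  special orthogonal group is trivial and would not determine the measure.\<close>

definition rotation_invariant_prob :: "real \<Rightarrow> (real^'n) measure \<Rightarrow> bool" where
  "rotation_invariant_prob r \<omega> \<longleftrightarrow>
     sets \<omega> = sets borel \<and> prob_space \<omega> \<and> (AE x in \<omega>. x \<in> sphere 0 r) \<and>
     (\<forall>T. orthogonal_transformation T \<longrightarrow> distr \<omega> borel T = \<omega>)"

definition sphere_prob :: "real \<Rightarrow> (real^'n) measure" where
  "sphere_prob r = (THE \<omega>. rotation_invariant_prob r \<omega>)"

text \<open>The rest of this section shows that the definite description is proper for \<open>r \<ge> 0\<close>.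
  The key fact is that a measure is determined by the common value it gives to balls of equal
  radius centred in its support.\<close>

lemma Fubini_ball:
  fixes M N :: "'a::euclidean_space measure"
  assumes [measurable_cong, simp]: "sets M = sets borel" "sets N = sets borel"
    and "sigma_finite_measure M" "sigma_finite_measure N"
    and [measurable]: "F \<in> sets borel"
  shows "(\<integral>\<^sup>+x. indicator F x * emeasure N (ball x e) \<partial>M) =
         (\<integral>\<^sup>+y. emeasure M (F \<inter> ball y e) \<partial>N)"
proof -
  interpret pair_sigma_finite M N
    using assms by (simp add: pair_sigma_finite_def)
  let ?g = "\<lambda>x y. indicator F x * indicator {p. dist (fst p) (snd p) < e} (x, y) :: ennreal"
  have "open {p::'a \<times> 'a. dist (fst p) (snd p) < e}"
    by (intro open_Collect_less continuous_intros)
  then have [measurable]: "{p::'a \<times> 'a. dist (fst p) (snd p) < e} \<in> sets (borel \<Otimes>\<^sub>M borel)"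
    by (subst borel_prod) (rule borel_open)
  have *: "sets (M \<Otimes>\<^sub>M N) = sets (borel \<Otimes>\<^sub>M borel :: ('a \<times> 'a) measure)"
    by (intro sets_pair_measure_cong) simp_all
  have meas: "case_prod ?g \<in> borel_measurable (M \<Otimes>\<^sub>M N)"
    by (subst measurable_cong_sets[OF * refl]) (simp add: case_prod_beta')
  have "(\<integral>\<^sup>+x. indicator F x * emeasure N (ball x e) \<partial>M) = (\<integral>\<^sup>+x. \<integral>\<^sup>+y. ?g x y \<partial>N \<partial>M)"
  proof (intro nn_integral_cong)
    fix x
    have "(\<integral>\<^sup>+y. ?g x y \<partial>N) = (\<integral>\<^sup>+y. indicator F x * indicator (ball x e) y \<partial>N)"
      by (intro nn_integral_cong) (auto simp: indicator_def)
    then show "indicator F x * emeasure N (ball x e) = (\<integral>\<^sup>+y. ?g x y \<partial>N)"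
      by (simp add: nn_integral_cmult_indicator)
  qed
  also have "\<dots> = (\<integral>\<^sup>+y. \<integral>\<^sup>+x. ?g x y \<partial>M \<partial>N)"
    by (rule Fubini'[OF meas, symmetric])
  also have "\<dots> = (\<integral>\<^sup>+y. emeasure M (F \<inter> ball y e) \<partial>N)"
  proof (intro nn_integral_cong)
    fix y
    have "(\<integral>\<^sup>+x. ?g x y \<partial>M) = (\<integral>\<^sup>+x. indicator (F \<inter> ball y e) x \<partial>M)"
      by (intro nn_integral_cong) (auto simp: indicator_def dist_commute)
    also have "\<dots> = emeasure M (F \<inter> ball y e)"
      by (rule nn_integral_indicator) simp
    finally show "(\<integral>\<^sup>+x. ?g x y \<partial>M) = emeasure M (F \<inter> ball y e)" .
  qed
  finally show ?thesis .
qed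

lemma emeasure_compact_le_of_balls:
  fixes M N :: "'a::euclidean_space measure"
  assumes sets[measurable_cong, simp]: "sets M = sets borel" "sets N = sets borel"
    and sf: "sigma_finite_measure M" "sigma_finite_measure N"
    and AE: "AE x in M. x \<in> S" "AE x in N. x \<in> S"
    and balls: "\<And>x e. x \<in> S \<Longrightarrow> 0 < e \<Longrightarrow> emeasure M (ball x e) = m e"
               "\<And>x e. x \<in> S \<Longrightarrow> 0 < e \<Longrightarrow> emeasure N (ball x e) = m e"
    and m: "\<And>e. 0 < e \<Longrightarrow> m e \<noteq> 0" "\<And>e. 0 < e \<Longrightarrow> m e \<noteq> \<infinity>"
    and fin: "\<And>x e. emeasure N (ball x e) \<noteq> \<infinity>"
    and F: "compact F"
  shows "emeasure M F \<le> emeasure N F"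
proof (cases "F = {}")
  case False
  define G where "G e = {y. infdist y F \<le> e}" for e
  have clG: "closed (G e)" for e
    unfolding G_def by (intro closed_Collect_le continuous_intros)
  have Gmono: "G d \<subseteq> G e" if "d \<le> e" for d e
    using that by (auto simp: G_def)
  have [measurable]: "G e \<in> sets borel" for e using clG by (rule borel_closed)
  have [measurable]: "F \<in> sets borel" using F by (simp add: borel_compact)
  have step: "emeasure M F \<le> emeasure N (G e)" if e: "e > 0" for e
  proof -
    have "m e * emeasure M F = (\<integral>\<^sup>+x. m e * indicator F x \<partial>M)"
      by (simp add: nn_integral_cmult_indicator)
    also have "\<dots> = (\<integral>\<^sup>+x. indicator F x * emeasure N (ball x e) \<partial>M)"
      using AE(1) by (intro nn_integral_cong_AE) (auto simp: balls e mult.commute)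
    also have "\<dots> = (\<integral>\<^sup>+y. emeasure M (F \<inter> ball y e) \<partial>N)"
      by (intro Fubini_ball sf) simp_all
    also have "\<dots> \<le> (\<integral>\<^sup>+y. m e * indicator (G e) y \<partial>N)"
    proof (intro nn_integral_mono_AE, use AE(2) in eventually_elim)
      fix y assume y: "y \<in> S"
      show "emeasure M (F \<inter> ball y e) \<le> m e * indicator (G e) y"
      proof (cases "F \<inter> ball y e = {}")
        case True then show ?thesis by (simp only: emeasure_empty zero_le)
      next
        case ne: False
        then have "y \<in> G e"
          by (auto simp: G_def intro: infdist_le2)
        moreover have "emeasure M (F \<inter> ball y e) \<le> emeasure M (ball y e)"
          by (intro emeasure_mono) auto
        ultimately show ?thesis using y e by (simp add: balls)
      qed
    qed
    also have "\<dots> = m e * emeasure N (G e)"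
      by (simp add: nn_integral_cmult_indicator)
    finally show ?thesis
      using m[OF e] by (simp add: ennreal_mult_le_mult_iff)
  qed
  define H where "H n = G (1 / real (Suc n))" for n
  have bG: "G 1 \<subseteq> (\<Union>x\<in>F. cball x 1)"
  proof
    fix y assume "y \<in> G 1"
    obtain x where "x \<in> F" "infdist y F = dist y x"
      using infdist_attains_inf[OF compact_imp_closed[OF F] \<open>F \<noteq> {}\<close>] .
    with \<open>y \<in> G 1\<close> show "y \<in> (\<Union>x\<in>F. cball x 1)"
      by (auto simp: G_def dist_commute)
  qed
  obtain R where R: "\<And>x. x \<in> F \<Longrightarrow> norm x \<le> R"
    using compact_imp_bounded[OF F] by (auto simp: bounded_iff)
  have sub: "H n \<subseteq> ball 0 (R + 2)" for n
  proof -
    have "H n \<subseteq> G 1"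
      unfolding H_def by (rule Gmono) simp
    also have "\<dots> \<subseteq> ball 0 (R + 2)"
    proof
      fix y assume "y \<in> G 1"
      then obtain x where "x \<in> F" "dist x y \<le> 1" using bG by auto
      then show "y \<in> ball 0 (R + 2)"
        using R[of x] norm_triangle_sub[of y x] by (auto simp: dist_norm norm_minus_commute)
    qed
    finally show ?thesis .
  qed
  have "emeasure N (H n) \<noteq> \<infinity>" for n
    using emeasure_mono[OF sub[of n], of N] fin[of 0 "R+2"] by (auto simp: top_unique)
  moreover have "decseq H"
    unfolding H_def decseq_def by (intro allI impI Gmono) (simp add: frac_le)
  moreover have "range H \<subseteq> sets N"
    by (auto simp: H_def)
  ultimately have lim: "(\<lambda>n. emeasure N (H n)) \<longlonglongrightarrow> emeasure N (\<Inter>n. H n)"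
    by (intro Lim_emeasure_decseq) auto
  have "(\<Inter>n. H n) = F"
  proof
    show "F \<subseteq> (\<Inter>n. H n)"
      by (auto simp: H_def G_def)
    show "(\<Inter>n. H n) \<subseteq> F"
    proof
      fix y assume y: "y \<in> (\<Inter>n. H n)"
      have "infdist y F \<le> 0"
      proof (rule LIMSEQ_le_const)
        show "(\<lambda>n. 1 / real (Suc n)) \<longlonglongrightarrow> 0"
          using LIMSEQ_inverse_real_of_nat by (simp add: inverse_eq_divide)
        show "\<exists>N. \<forall>n\<ge>N. infdist y F \<le> 1 / real (Suc n)"
          using y by (auto simp: H_def G_def)
      qed
      then show "y \<in> F"
        using in_closed_iff_infdist_zero[OF compact_imp_closed[OF F] \<open>F \<noteq> {}\<close>, of y]
          infdist_nonneg[of y F] by auto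
    qed
  qed
  with lim show ?thesis
    by (metis (no_types, lifting) H_def LIMSEQ_le_const step of_nat_0_less_iff zero_less_Suc
        zero_less_divide_1_iff)
qed simp

lemma measure_eqI_compact:
  fixes M N :: "'a::euclidean_space measure"
  assumes sets: "sets M = sets borel" "sets N = sets borel"
    and fin: "\<And>x e. emeasure M (ball x e) \<noteq> \<infinity>"
    and eq: "\<And>F. compact F \<Longrightarrow> emeasure M F = emeasure N F"
  shows "M = N"
proof -
  have gen: "sets borel = sigma_sets UNIV (Collect compact :: 'a set set)"
  proof
    show "sigma_sets UNIV (Collect compact) \<subseteq> sets (borel :: 'a measure)"
      by (intro sets.sigma_sets_subset[where M=borel, simplified]) (auto intro: borel_compact)
    have "sets (borel :: 'a measure) = sigma_sets UNIV (Collect closed)"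
      by (subst borel_eq_closed) simp
    also have "\<dots> \<subseteq> sigma_sets UNIV (Collect compact)"
    proof (rule sigma_sets_mono, safe)
      fix F :: "'a set" assume "closed F"
      then have "F \<inter> cball 0 (real n) \<in> sigma_sets UNIV (Collect compact)" for n
        by (intro sigma_sets.Basic) (auto intro: closed_Int_compact)
      then have "(\<Union>n. F \<inter> cball 0 (real n)) \<in> sigma_sets UNIV (Collect compact)"
        by (rule sigma_sets.Union)
      moreover have "(\<Union>n. F \<inter> cball 0 (real n)) = F"
        by (auto simp: real_arch_simple)
      ultimately show "F \<in> sigma_sets UNIV (Collect compact)" by simp
    qed
    finally show "sets (borel :: 'a measure) \<subseteq> sigma_sets UNIV (Collect compact)" .
  qed
  show ?thesis
  proof (rule measure_eqI_generator_eq[where E="Collect compact" and \<Omega>=UNIV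
        and A="\<lambda>n. cball 0 (real n)"])
    show "Int_stable (Collect compact :: 'a set set)"
      by (auto simp: Int_stable_def compact_Int)
    show "(\<Union>n. cball (0::'a) (real n)) = UNIV"
      by (auto simp: real_arch_simple)
    fix n
    have "emeasure M (cball 0 (real n)) \<le> emeasure M (ball 0 (real n + 1))"
      by (intro emeasure_mono) (auto simp: sets)
    then show "emeasure M (cball 0 (real n)) \<noteq> \<infinity>"
      using fin[of 0 "real n + 1"] by (auto simp: top_unique)
  qed (use eq sets gen in auto)
qed

lemma orthogonal_vimage_ball:
  fixes T :: "'a::euclidean_space \<Rightarrow> 'a"
  assumes "orthogonal_transformation T"
  shows "T -` ball (T x) e = ball x e"
  using assms
  by (auto simp: dist_norm orthogonal_transformation_norm
      simp flip: linear_diff[OF orthogonal_transformation_linear[OF assms]])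

lemma orthogonal_measurable:
  fixes T :: "'a::euclidean_space \<Rightarrow> 'a"
  assumes "orthogonal_transformation T"
  shows "T \<in> borel_measurable borel"
  by (intro borel_measurable_continuous_onI linear_continuous_on
      linear_conv_bounded_linear[THEN iffD1] orthogonal_transformation_linear assms)

lemma lborel_distr_orthogonal:
  fixes T :: "'a::euclidean_space \<Rightarrow> 'a"
  assumes T: "orthogonal_transformation T"
  shows "distr lborel borel T = lborel"
proof -
  let ?M = "distr lborel borel T"
  note [measurable] = orthogonal_measurable[OF T]
  define m where "m e = emeasure lborel (ball (0::'a) e)" for e
  have lb: "emeasure lborel (ball x e) = m e" for x :: 'a and e
    by (cases "e \<ge> 0") (auto simp: m_def emeasure_ball ball_empty)
  have Mb: "emeasure ?M (ball x e) = m e" for x e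
  proof -
    obtain y where "x = T y"
      using orthogonal_transformation_surj[OF T] by (metis surjD)
    then show ?thesis
      by (simp add: emeasure_distr orthogonal_vimage_ball[OF T] lb)
  qed
  have fin: "m e \<noteq> \<infinity>" for e
    using emeasure_bounded_finite[OF bounded_ball, of "0::'a" e] by (simp add: m_def)
  have pos: "m e \<noteq> 0" if "e > 0" for e
    using that unit_ball_vol_pos[of "real DIM('a)"] by (simp add: m_def emeasure_ball less_imp_neq[symmetric] del: unit_ball_vol_pos)
  have sf: "sigma_finite_measure ?M"
  proof
    show "\<exists>A. countable A \<and> A \<subseteq> sets ?M \<and> \<Union> A = space ?M \<and> (\<forall>a\<in>A. emeasure ?M a \<noteq> \<infinity>)"
      by (intro exI[of _ "range (\<lambda>n. ball 0 (real n))"])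
        (use fin in \<open>auto simp: Mb reals_Archimedean2\<close>)
  qed
  have sf': "sigma_finite_measure (lborel :: 'a measure)" ..
  show ?thesis
  proof (rule measure_eqI_compact)
    fix F :: "'a set" assume F: "compact F"
    show "emeasure ?M F = emeasure lborel F"
      by (intro antisym emeasure_compact_le_of_balls[where S=UNIV and m=m] F sf sf')
        (auto simp: Mb lb fin[simplified] pos)
  qed (auto simp: Mb fin[simplified])
qed

lemma rotation_invariant_prob_exists:
  assumes "r \<ge> 0"
  shows "\<exists>\<omega> :: (real^'n) measure. rotation_invariant_prob r \<omega>"
proof -
  let ?B = "ball (0::real^'n) 1"
  let ?U = "uniform_measure lborel ?B"
  let ?h = "\<lambda>x::real^'n. r *\<^sub>R sgn x"
  have B: "emeasure lborel ?B \<noteq> 0" "emeasure lborel ?B \<noteq> \<infinity>"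
    using emeasure_bounded_finite[OF bounded_ball, of "0::real^'n" 1]
      unit_ball_vol_pos[of "real CARD('n)"]
    by (auto simp: emeasure_ball simp del: unit_ball_vol_pos)
  interpret U: prob_space ?U
    using B by (rule prob_space_uniform_measure)
  have h[measurable]: "?h \<in> borel_measurable borel"
    unfolding sgn_div_norm by measurable
  have "rotation_invariant_prob r (distr ?U borel ?h)"
    unfolding rotation_invariant_prob_def
  proof (intro conjI allI impI)
    show "prob_space (distr ?U borel ?h)"
      by (rule U.prob_space_distr) measurable
    have "AE x in lborel. x \<noteq> (0::real^'n)"
      by (rule AE_lborel_singleton)
    then have "AE x in ?U. x \<noteq> 0"
      by (intro AE_uniform_measureI) auto
    then show "AE x in distr ?U borel ?h. x \<in> sphere 0 r"
      using assms by (subst AE_distr_iff) (auto simp: norm_sgn)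
    fix T :: "real^'n \<Rightarrow> real^'n" assume T: "orthogonal_transformation T"
    note [measurable] = orthogonal_measurable[OF T]
    have comm: "T (?h x) = ?h (T x)" for x
      by (simp add: sgn_div_norm orthogonal_transformation_norm[OF T]
          linear_scale[OF orthogonal_transformation_linear[OF T]])
    have TU: "distr ?U borel T = ?U"
    proof (rule measure_eqI)
      fix A assume "A \<in> sets (distr ?U borel T)"
      then have A[measurable]: "A \<in> sets borel" by simp
      have TB: "T -` ?B = ?B"
        using orthogonal_vimage_ball[OF T, of 0 1]
        by (simp add: linear_0[OF orthogonal_transformation_linear[OF T]])
      have "emeasure (distr ?U borel T) A = emeasure lborel (?B \<inter> T -` A) / emeasure lborel ?B"
        using measurable_sets[OF orthogonal_measurable[OF T] A] by (simp add: emeasure_distr)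
      also have "?B \<inter> T -` A = T -` (?B \<inter> A)" using TB by auto
      also have "emeasure lborel (T -` (?B \<inter> A)) = emeasure (distr lborel borel T) (?B \<inter> A)"
        by (subst emeasure_distr) auto
      also have "\<dots> = emeasure lborel (?B \<inter> A)"
        by (simp add: lborel_distr_orthogonal[OF T])
      finally show "emeasure (distr ?U borel T) A = emeasure ?U A" by simp
    qed simp
    have "distr (distr ?U borel ?h) borel T = distr ?U borel (\<lambda>x. T (?h x))"
      by (subst distr_distr) (auto simp: comp_def)
    also have "\<dots> = distr ?U borel (\<lambda>x. ?h (T x))"
      by (simp add: comm)
    also have "\<dots> = distr (distr ?U borel T) borel ?h"
      by (subst distr_distr) (auto simp: comp_def)
    also have "\<dots> = distr ?U borel ?h"
      by (simp add: TU)
    finally show "distr (distr ?U borel ?h) borel T = distr ?U borel ?h" .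
  qed simp
  then show ?thesis ..
qed

lemma rotation_invariant_prob_ball:
  fixes \<omega> :: "(real^'n) measure"
  assumes \<omega>: "rotation_invariant_prob r \<omega>" and xy: "norm x = norm y"
  shows "emeasure \<omega> (ball x e) = emeasure \<omega> (ball y e)"
proof -
  obtain T where T: "orthogonal_transformation T" "T x = y"
    using orthogonal_transformation_exists[OF xy] .
  have s: "sets \<omega> = sets borel" "space \<omega> = UNIV" and d: "distr \<omega> borel T = \<omega>"
    using \<omega> T(1) sets_eq_imp_space_eq[of \<omega> borel] by (auto simp: rotation_invariant_prob_def)
  have [measurable]: "T \<in> \<omega> \<rightarrow>\<^sub>M borel"
    using orthogonal_measurable[OF T(1)] by (simp add: measurable_cong_sets[OF s(1) refl])
  have "emeasure (distr \<omega> borel T) (ball y e) = emeasure \<omega> (T -` ball (T x) e)"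
    by (subst emeasure_distr) (auto simp: s T(2))
  then show ?thesis
    by (simp add: d orthogonal_vimage_ball[OF T(1)])
qed

lemma rotation_invariant_prob_unique:
  fixes \<mu> \<nu> :: "(real^'n) measure"
  assumes \<mu>: "rotation_invariant_prob r \<mu>" and \<nu>: "rotation_invariant_prob r \<nu>"
  shows "\<mu> = \<nu>"
proof -
  have sets[simp]: "sets \<mu> = sets borel" "sets \<nu> = sets borel"
    and AE: "AE x in \<mu>. x \<in> sphere 0 r" "AE x in \<nu>. x \<in> sphere 0 r"
    and ps: "prob_space \<mu>" "prob_space \<nu>"
    using \<mu> \<nu> by (auto simp: rotation_invariant_prob_def)
  interpret \<mu>: prob_space \<mu> by fact
  interpret \<nu>: prob_space \<nu> by fact
  have sf: "sigma_finite_measure \<mu>" "sigma_finite_measure \<nu>" ..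
  have sp: "space \<mu> = UNIV" "space \<nu> = UNIV"
    using sets_eq_imp_space_eq[OF sets(1)] sets_eq_imp_space_eq[OF sets(2)] by auto
  have one: "emeasure \<mu> UNIV = 1" "emeasure \<nu> UNIV = 1"
    using \<mu>.emeasure_space_1 \<nu>.emeasure_space_1 by (auto simp: sp)
  obtain z :: "real^'n" where z: "norm z = r"
  proof -
    have "\<exists>x::real^'n. x \<in> sphere 0 r"
    proof (rule ccontr)
      assume "\<not> ?thesis"
      then have "AE x in \<mu>. False" using AE(1) by simp
      then show False by simp
    qed
    then show ?thesis using that by auto
  qed
  have eq: "emeasure \<mu> (ball z e) = emeasure \<nu> (ball z e)" for e
  proof -
    have "emeasure \<nu> (ball z e) = (\<integral>\<^sup>+x. indicator UNIV x * emeasure \<nu> (ball z e) \<partial>\<mu>)"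
      by (simp add: \<mu>.emeasure_space_1)
    also have "\<dots> = (\<integral>\<^sup>+x. indicator UNIV x * emeasure \<nu> (ball x e) \<partial>\<mu>)"
      by (intro nn_integral_cong_AE, use AE(1) in eventually_elim)
        (auto simp: z intro!: rotation_invariant_prob_ball[OF \<nu>])
    also have "\<dots> = (\<integral>\<^sup>+y. emeasure \<mu> (UNIV \<inter> ball y e) \<partial>\<nu>)"
      by (intro Fubini_ball sf) simp_all
    also have "\<dots> = (\<integral>\<^sup>+y. emeasure \<mu> (ball z e) \<partial>\<nu>)"
      by (intro nn_integral_cong_AE, use AE(2) in eventually_elim)
        (auto simp: z intro!: rotation_invariant_prob_ball[OF \<mu>])
    also have "\<dots> = emeasure \<mu> (ball z e)"
      by (simp add: \<nu>.emeasure_space_1)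
    finally show ?thesis ..
  qed
  have pos: "emeasure \<mu> (ball z e) \<noteq> 0" if e: "e > 0" for e
  proof
    assume 0: "emeasure \<mu> (ball z e) = 0"
    have "compact (sphere (0::real^'n) r)" by simp
    moreover have "sphere (0::real^'n) r \<subseteq> (\<Union>x\<in>sphere 0 r. ball x e)" using e by force
    ultimately obtain C where C: "C \<subseteq> sphere (0::real^'n) r" "finite C"
        "sphere 0 r \<subseteq> (\<Union>x\<in>C. ball x e)"
      using compactE_image[of "sphere (0::real^'n) r" "sphere 0 r" "\<lambda>x. ball x e"]
      by (metis open_ball)
    have "(\<Union>x\<in>C. ball x e) \<in> null_sets \<mu>"
    proof (intro null_sets.finite_UN C)
      fix x assume "x \<in> C"
      then have "emeasure \<mu> (ball x e) = emeasure \<mu> (ball z e)"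
        using C(1) by (intro rotation_invariant_prob_ball[OF \<mu>]) (auto simp: z)
      then show "ball x e \<in> null_sets \<mu>" using 0 by auto
    qed
    from AE_not_in[OF this] AE(1) have "AE x in \<mu>. False"
      by eventually_elim (use C(3) in auto)
    then show False by simp
  qed
  define m where "m e = emeasure \<mu> (ball z e)" for e
  have fin: "m e \<noteq> \<infinity>" for e
    by (simp add: m_def)
  have b: "emeasure \<mu> (ball x e) = m e" "emeasure \<nu> (ball x e) = m e"
    if "x \<in> sphere 0 r" for x e
  proof -
    have "norm x = norm z" using that z by simp
    then show "emeasure \<mu> (ball x e) = m e" "emeasure \<nu> (ball x e) = m e"
      unfolding m_def using rotation_invariant_prob_ball[OF \<mu>] rotation_invariant_prob_ball[OF \<nu>] eq
      by metis+
  qed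
  note pos' = pos[folded m_def]
  show ?thesis
  proof (rule measure_eqI_compact)
    fix F :: "(real^'n) set" assume F: "compact F"
    show "emeasure \<mu> F = emeasure \<nu> F"
    proof (rule antisym)
      show "emeasure \<mu> F \<le> emeasure \<nu> F"
        by (rule emeasure_compact_le_of_balls[OF sets sf AE b pos' fin _ F]) (simp_all)
      show "emeasure \<nu> F \<le> emeasure \<mu> F"
        by (rule emeasure_compact_le_of_balls[OF sets(2,1) sf(2,1) AE(2,1) b(2,1) pos' fin _ F]) (simp_all)
    qed
  qed simp_all
qed

lemma rotation_invariant_prob_sphere_prob:
  assumes "r \<ge> 0"
  shows "rotation_invariant_prob r (sphere_prob r :: (real^'n) measure)"
  unfolding sphere_prob_def
proof (rule theI')
  show "\<exists>!\<omega> :: (real^'n) measure. rotation_invariant_prob r \<omega>"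
    using rotation_invariant_prob_exists[OF assms]
    by (rule ex_ex1I) (rule rotation_invariant_prob_unique)
qed


section \<open>Spherical designs\<close>

text \<open>Exponent vectors \<open>m\<close> of total degree at most \<open>M\<close> form a finite set, so the sum below
  is an ordinary finite one.\<close>

definition polynomial_of_degree_le :: "nat \<Rightarrow> (real^'n \<Rightarrow> real) \<Rightarrow> bool" where
  "polynomial_of_degree_le M q \<longleftrightarrow>
     (\<exists>a :: ('n \<Rightarrow> nat) \<Rightarrow> real.
        q = (\<lambda>x. \<Sum>m | (\<Sum>i\<in>UNIV. m i) \<le> M. a m * (\<Prod>i\<in>UNIV. (x $ i) ^ m i)))"

lemma finite_exponents_of_degree_le: "finite {m :: 'n::finite \<Rightarrow> nat. (\<Sum>i\<in>UNIV. m i) \<le> M}"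
proof (rule finite_subset)
  show "{m :: 'n \<Rightarrow> nat. (\<Sum>i\<in>UNIV. m i) \<le> M} \<subseteq> UNIV \<rightarrow>\<^sub>E {..M}"
  proof
    fix m :: "'n \<Rightarrow> nat" assume m: "m \<in> {m. (\<Sum>i\<in>UNIV. m i) \<le> M}"
    have "m i \<le> (\<Sum>i\<in>UNIV. m i)" for i
      by (rule member_le_sum) auto
    moreover have "(\<Sum>i\<in>UNIV. m i) \<le> M" using m by simp
    ultimately have "m i \<le> M" for i by (rule order_trans)
    then show "m \<in> UNIV \<rightarrow>\<^sub>E {..M}" by auto
  qed
qed (simp add: finite_PiE)

definition spherical_design :: "nat \<Rightarrow> real^'n \<Rightarrow> real \<Rightarrow> (real^'n) set \<Rightarrow> bool" where
  "spherical_design M z r X \<longleftrightarrow>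
     finite X \<and> X \<noteq> {} \<and> X \<subseteq> sphere z r \<and>
     (\<forall>q. polynomial_of_degree_le M q \<longrightarrow>
        (\<integral>y. q y \<partial>sphere_prob r) = (\<Sum>x\<in>X. q (x - z)) / real (card X))"


section \<open>Lattices, deep holes and cold spots\<close>

definition full_lattice :: "(real^'n) set \<Rightarrow> bool" where
  "full_lattice L \<longleftrightarrow>
     (\<exists>B. independent B \<and> span B = UNIV \<and>
          L = range (\<lambda>k :: real^'n \<Rightarrow> int. \<Sum>b\<in>B. of_int (k b) *\<^sub>R b))"

text \<open>For a lattice the infimum in \<^const>\<open>infdist\<close> is attained, so \<open>infdist z L\<close> is the minimum of
  \<open>norm (x - z)\<close> over \<open>x \<in> L\<close>, and a deep hole is a point maximising it.\<close>

definition deep_hole :: "(real^'n) set \<Rightarrow> real^'n \<Rightarrow> bool" where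
  "deep_hole L c \<longleftrightarrow> (\<forall>z. infdist z L \<le> infdist c L)"

definition affine_isometry :: "(real^'n \<Rightarrow> real^'n) \<Rightarrow> bool" where
  "affine_isometry f \<longleftrightarrow> (\<exists>T b. orthogonal_transformation T \<and> f = (\<lambda>x. T x + b))"

definition shell :: "(real^'n) set \<Rightarrow> real^'n \<Rightarrow> real \<Rightarrow> (real^'n) set" where
  "shell L c r = {x \<in> L. norm (x - c) = r}"

text \<open>When \<open>L\<close> is a lattice the sum converges exactly for \<open>\<alpha> > 0\<close>; for other \<open>\<alpha>\<close> the library value of
  the divergent sum is 0. This does not affect \<open>stable_cold_spot\<close> below, where \<open>\<alpha>\<^sub>0\<close> may always be
  enlarged.\<close>

definition gaussian_sum :: "(real^'n) set \<Rightarrow> real \<Rightarrow> real^'n \<Rightarrow> real" where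
  "gaussian_sum L \<alpha> z = (\<Sum>\<^sub>\<infinity>x\<in>L. exp (- \<alpha> * (norm (x - z))\<^sup>2))"

definition stable_cold_spot :: "(real^'n) set \<Rightarrow> real^'n \<Rightarrow> bool" where
  "stable_cold_spot L c \<longleftrightarrow> (\<exists>\<alpha>\<^sub>0. \<forall>\<alpha>\<ge>\<alpha>\<^sub>0. \<forall>z. gaussian_sum L \<alpha> c \<le> gaussian_sum L \<alpha> z)"

end

theory Submission
  imports Defs
begin

text \<open>Away from the deep holes the distance to \<open>L\<close> is bounded by some \<open>m < \<mu>\<close>, where \<open>\<mu>\<close> is the
  covering radius, so for large \<open>\<alpha>\<close> one term \<open>e\<^bsup>-\<alpha>m\<^sup>2\<^esup>\<close> already exceeds the whole sum at \<open>c\<close>, which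
  is \<open>O(e\<^bsup>-\<alpha>\<mu>\<^sup>2\<^esup>)\<close>. Near a deep hole symmetry reduces to points \<open>c + v\<close> with \<open>v\<close> small. There the
  comparison holds shell by shell: on a shell of radius \<open>r\<close> it says that the average of
  \<open>exp t\<close>, with \<open>t = 2\<alpha>\<langle>x - c, v\<rangle>\<close>, is at least \<open>e\<^bsup>\<alpha>|v|\<^sup>2\<^esup>\<close>. The 2-design property gives the mean and
  the variance of \<open>t\<close>, and a quadratic minorant of \<open>exp\<close> on \<open>{-2\<alpha>r|v|..}\<close> turns these into a bound
  that does not depend on the size of the shell, so that one \<open>\<alpha>\<^sub>0\<close> serves all shells.\<close>

section \<open>The exponential mean of a centred family\<close>

text \<open>For negative arguments the extreme case is \<open>B = - t\<close>, where the left side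
  equals \<open>(2 - B) / (2 + B)\<close>, the Pade approximant of \<open>exp (- B)\<close>. A
  larger \<open>B\<close> only shrinks the quadratic coefficient.\<close>

lemma exp_ge_quadratic:
  fixes t B :: real
  assumes "- B \<le> t" "0 \<le> B"
  shows "1 + t + t\<^sup>2 / (2 + B) \<le> exp t"
proof (cases "0 \<le> t")
  case True
  have "1 + t + t\<^sup>2 / (2 + B) \<le> 1 + t + t\<^sup>2 / 2"
    using assms by (intro add_left_mono divide_left_mono) auto
  also have "\<dots> \<le> exp t" by (rule exp_lower_Taylor_quadratic[OF True])
  finally show ?thesis .
next
  case False
  define u where "u = - t"
  have u: "0 \<le> u" "u \<le> B" using False assms by (auto simp: u_def)
  \<comment> \<open>The left side is the value 0 at the origin, left unevaluated to match the
    monotonicity rule; the derivative is nonnegative because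
    \<open>1 + x \<le> exp x\<close>.\<close>
  have "(2 + 0) * exp (- 0) + 0 - 2 \<le> (2 + u) * exp (- u) + u - 2"
  proof (rule DERIV_nonneg_imp_nondecreasing[OF u(1)])
    fix x :: real assume x: "0 \<le> x" "x \<le> u"
    have "(1 + x) * exp (- x) \<le> exp x * exp (- x)"
      by (intro mult_right_mono) auto
    then have "0 \<le> 1 - (1 + x) * exp (- x)" by (simp flip: exp_add)
    moreover have "((\<lambda>u. (2 + u) * exp (- u) + u - 2) has_real_derivative 1 - (1 + x) * exp (- x)) (at x)"
      by (auto intro!: derivative_eq_intros simp: algebra_simps)
    ultimately show "\<exists>y. ((\<lambda>u. (2 + u) * exp (- u) + u - 2) has_real_derivative y) (at x) \<and> 0 \<le> y"
      by blast
  qed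
  then have "2 - u \<le> (2 + u) * exp (- u)" by simp
  then have "1 - u + u\<^sup>2 / (2 + u) \<le> exp (- u)"
    using u by (simp add: divide_simps) (simp add: algebra_simps power2_eq_square)
  moreover have "u\<^sup>2 / (2 + B) \<le> u\<^sup>2 / (2 + u)"
    using u by (intro divide_left_mono) auto
  ultimately show ?thesis by (simp add: u_def)
qed

text \<open>The bound is the average of the quadratic minorant of \<^const>\<open>exp\<close> around \<open>s\<close>. The choice
  \<open>s = A / N\<close> comes from the vertices of a simplex, where \<open>t\<close> takes only the values
  \<open>- A\<close> and \<open>A / N\<close>.\<close>

lemma sum_exp_ge_of_moments:
  fixes t :: "'a \<Rightarrow> real"
  assumes lb: "\<And>y. y \<in> S \<Longrightarrow> - A \<le> t y"
    and mean: "(\<Sum>y\<in>S. t y) = 0" and var: "real (card S) * (A\<^sup>2 / N) \<le> (\<Sum>y\<in>S. (t y)\<^sup>2)"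
    and A: "0 \<le> A" and N: "1 < N" and s: "s = A / N"
  shows "real (card S) * exp ((N - 1) * s\<^sup>2 / (2 + (N - 1) * s)) \<le> (\<Sum>y\<in>S. exp (t y))"
proof -
  have s0: "0 \<le> s" and As: "A = N * s" using A N s by auto
  \<comment> \<open>Since \<open>t y \<ge> - A = - N * s\<close>, the shifted value
    \<open>t y - s\<close> is at least \<open>- (N + 1) * s\<close>.\<close>
  define B where "B = (N + 1) * s"
  have B: "0 \<le> B" using s0 N by (simp add: B_def)
  have "(\<Sum>y\<in>S. 1 + (t y - s) + (t y - s)\<^sup>2 / (2 + B)) \<le> (\<Sum>y\<in>S. exp (t y - s))"
  proof (intro sum_mono exp_ge_quadratic B)
    fix y assume "y \<in> S"
    from lb[OF this] show "- B \<le> t y - s" by (simp add: B_def As algebra_simps)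
  qed
  also have "\<dots> = exp (- s) * (\<Sum>y\<in>S. exp (t y))"
    by (simp add: exp_diff exp_minus sum_distrib_left field_simps)
  also have "(\<Sum>y\<in>S. 1 + (t y - s) + (t y - s)\<^sup>2 / (2 + B)) =
      (\<Sum>y\<in>S. (1 - s) + t y + ((t y)\<^sup>2 + s\<^sup>2 - 2 * s * t y) / (2 + B))"
    by (intro sum.cong) (auto simp: power2_diff algebra_simps)
  also have "\<dots> = real (card S) * (1 - s) + ((\<Sum>y\<in>S. (t y)\<^sup>2) + real (card S) * s\<^sup>2) / (2 + B)"
    using mean by (simp add: sum.distrib sum_subtractf flip: sum_divide_distrib sum_distrib_left)
  finally have 1: "real (card S) * (1 - s) + ((\<Sum>y\<in>S. (t y)\<^sup>2) + real (card S) * s\<^sup>2) / (2 + B)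
      \<le> exp (- s) * (\<Sum>y\<in>S. exp (t y))" .
  have "A\<^sup>2 / N = N * s\<^sup>2" using N by (simp add: As power2_eq_square)
  then have "real (card S) * (N * s\<^sup>2) + real (card S) * s\<^sup>2 \<le> (\<Sum>y\<in>S. (t y)\<^sup>2) + real (card S) * s\<^sup>2"
    using var by simp
  then have "(real (card S) * (N * s\<^sup>2) + real (card S) * s\<^sup>2) / (2 + B)
      \<le> ((\<Sum>y\<in>S. (t y)\<^sup>2) + real (card S) * s\<^sup>2) / (2 + B)"
    using B by (intro divide_right_mono) auto
  with 1 have 2: "real (card S) * (1 - s) + (real (card S) * (N * s\<^sup>2) + real (card S) * s\<^sup>2) / (2 + B)
      \<le> exp (- s) * (\<Sum>y\<in>S. exp (t y))" by linarith
  have eq: "real (card S) * (1 - s) + (real (card S) * (N * s\<^sup>2) + real (card S) * s\<^sup>2) / (2 + B)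
      = real (card S) * ((2 + (N - 1) * s) / (2 + (N + 1) * s))"
    using B unfolding B_def by (simp add: divide_simps) (simp add: algebra_simps power2_eq_square)
  \<comment> \<open>The averaged minorant computed above is exactly \<open>1 / (1 + x)\<close>, and
    this is at least \<open>exp (- x)\<close>. Undoing the shift by \<open>s\<close> leaves the
    exponent \<open>s - x\<close>, which is the claimed one.\<close>
  define x where "x = 2 * s / (2 + (N - 1) * s)"
  have pos: "0 < 2 + (N - 1) * s" "0 < 2 + (N + 1) * s"
    using s0 N by (auto intro!: add_pos_nonneg)
  have x0: "0 \<le> x" using s0 pos by (simp add: x_def)
  have "inverse (exp x) \<le> inverse (1 + x)"
    using x0 by (intro le_imp_inverse_le) auto
  also have "1 + x = (2 + (N + 1) * s) / (2 + (N - 1) * s)"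
    using pos by (simp add: x_def divide_simps) (simp add: algebra_simps)
  finally have "exp (- x) \<le> (2 + (N - 1) * s) / (2 + (N + 1) * s)"
    by (simp add: exp_minus)
  then have "real (card S) * exp (- x) \<le> exp (- s) * (\<Sum>y\<in>S. exp (t y))"
    using 2 unfolding eq by (meson mult_left_mono of_nat_0_le_iff order_trans)
  then have "exp s * (real (card S) * exp (- x)) \<le> exp s * (exp (- s) * (\<Sum>y\<in>S. exp (t y)))"
    by (intro mult_left_mono) auto
  then have "real (card S) * exp (s - x) \<le> (\<Sum>y\<in>S. exp (t y))"
    by (simp add: exp_diff exp_minus field_simps)
  moreover have "s - x = (N - 1) * s\<^sup>2 / (2 + (N - 1) * s)"
    using pos by (simp add: x_def divide_simps) (simp add: algebra_simps power2_eq_square)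
  ultimately show ?thesis by simp
qed

text \<open>Expanding the square turns the claim into a lower bound
  \<open>exp (\<alpha> * (norm v)\<^sup>2)\<close> for the mean of
  \<open>exp (2 * \<alpha> * ((x - c) \<bullet> v))\<close>, to which the moment bound applies. The
  conditions on \<open>v\<close> and \<open>\<alpha>\<close> become weaker as \<open>r\<close>
  grows, so meeting them for the smallest shell meets them for all.\<close>

lemma sum_gaussian_ge_of_moments:
  fixes c v :: "'a::real_inner"
  assumes nrm: "\<And>x. x \<in> S \<Longrightarrow> norm (x - c) = r"
    and mean: "(\<Sum>x\<in>S. (x - c) \<bullet> v) = 0"
    and var: "real (card S) * ((r * norm v)\<^sup>2 / N) \<le> (\<Sum>x\<in>S. ((x - c) \<bullet> v)\<^sup>2)"
    and N: "1 < N" and r: "0 < r" and v: "norm v \<le> r / N"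
    and \<alpha>: "0 < \<alpha>" "N\<^sup>2 \<le> \<alpha> * r\<^sup>2 * (N - 1)"
  shows "real (card S) * exp (- \<alpha> * r\<^sup>2) \<le> (\<Sum>x\<in>S. exp (- \<alpha> * (norm (x - (c + v)))\<^sup>2))"
proof -
  define A where "A = 2 * \<alpha> * (r * norm v)"
  define s where "s = A / N"
  have pos: "0 < 2 + (N - 1) * s"
    using N \<alpha> r by (auto intro!: add_pos_nonneg simp: s_def A_def)
  have sv: "s = 2 * \<alpha> * r * norm v / N" by (simp add: s_def A_def)
  have "real (card S) * exp ((N - 1) * s\<^sup>2 / (2 + (N - 1) * s)) \<le> (\<Sum>x\<in>S. exp (2 * \<alpha> * ((x - c) \<bullet> v)))"
  proof (rule sum_exp_ge_of_moments[OF _ _ _ _ N s_def])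
    fix x assume "x \<in> S"
    then have "\<bar>(x - c) \<bullet> v\<bar> \<le> r * norm v"
      using Cauchy_Schwarz_ineq2[of "x - c" v] nrm by simp
    then show "- A \<le> 2 * \<alpha> * ((x - c) \<bullet> v)"
      using \<alpha> unfolding A_def by (smt (verit) mult_left_mono mult_minus_right)
  next
    show "(\<Sum>x\<in>S. 2 * \<alpha> * ((x - c) \<bullet> v)) = 0"
      using mean by (simp flip: sum_distrib_left)
    have "(2 * \<alpha>)\<^sup>2 * (real (card S) * ((r * norm v)\<^sup>2 / N)) \<le> (2 * \<alpha>)\<^sup>2 * (\<Sum>x\<in>S. ((x - c) \<bullet> v)\<^sup>2)"
      by (intro mult_left_mono var) auto
    then show "real (card S) * (A\<^sup>2 / N) \<le> (\<Sum>x\<in>S. (2 * \<alpha> * ((x - c) \<bullet> v))\<^sup>2)"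
      by (simp add: A_def power_mult_distrib sum_distrib_left mult_ac)
    show "0 \<le> A" using \<alpha> r by (simp add: A_def)
  qed
  moreover have "\<alpha> * (norm v)\<^sup>2 \<le> (N - 1) * s\<^sup>2 / (2 + (N - 1) * s)"
  proof -
    \<comment> \<open>The target rearranges to \<open>2 + (N - 1) * s \<le> 4 * E\<close>. The lower
      bound on \<open>\<alpha>\<close> pays for the summand 2, the upper bound on
      \<open>norm v\<close> for the other summand.\<close>
    define E where "E = \<alpha> * r\<^sup>2 * (N - 1) / N\<^sup>2"
    have "1 \<le> E" using \<alpha> N by (simp add: E_def)
    moreover have "(N - 1) * s \<le> 2 * E"
    proof -
      have "(N - 1) * s = ((N - 1) * 2 * \<alpha> * r / N) * norm v" by (simp add: sv)
      also have "\<dots> \<le> ((N - 1) * 2 * \<alpha> * r / N) * (r / N)"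
        using v N \<alpha> r by (intro mult_left_mono) auto
      finally show ?thesis by (simp add: E_def power2_eq_square mult_ac)
    qed
    ultimately have "2 + (N - 1) * s \<le> 4 * E" by linarith
    then have "\<alpha> * (norm v)\<^sup>2 * (2 + (N - 1) * s) \<le> \<alpha> * (norm v)\<^sup>2 * (4 * E)"
      using \<alpha> by (intro mult_left_mono) auto
    also have "\<dots> = (N - 1) * s\<^sup>2"
      by (simp add: sv E_def power2_eq_square)
    finally show ?thesis using pos by (simp add: pos_le_divide_eq)
  qed
  ultimately have 1: "real (card S) * exp (\<alpha> * (norm v)\<^sup>2) \<le> (\<Sum>x\<in>S. exp (2 * \<alpha> * ((x - c) \<bullet> v)))"
    by (smt (verit) exp_le_cancel_iff mult_left_mono of_nat_0_le_iff)
  have eq: "(norm (x - (c + v)))\<^sup>2 = r\<^sup>2 + (norm v)\<^sup>2 - 2 * ((x - c) \<bullet> v)" if "x \<in> S" for x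
  proof -
    have "(norm (x - c - v))\<^sup>2 = (norm (x - c))\<^sup>2 + (norm v)\<^sup>2 - 2 * ((x - c) \<bullet> v)"
      by (simp add: power2_norm_eq_inner inner_diff inner_commute)
    then show ?thesis using nrm[OF that] by (simp add: diff_diff_add)
  qed
  have "(\<Sum>x\<in>S. exp (- \<alpha> * (norm (x - (c + v)))\<^sup>2)) =
      (\<Sum>x\<in>S. exp (- \<alpha> * r\<^sup>2 - \<alpha> * (norm v)\<^sup>2) * exp (2 * \<alpha> * ((x - c) \<bullet> v)))"
    by (intro sum.cong refl, subst eq) (auto simp: right_diff_distrib distrib_left simp flip: exp_add)
  also have "\<dots> = exp (- \<alpha> * r\<^sup>2 - \<alpha> * (norm v)\<^sup>2) * (\<Sum>x\<in>S. exp (2 * \<alpha> * ((x - c) \<bullet> v)))"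
    by (simp add: sum_distrib_left)
  also have "\<dots> \<ge> exp (- \<alpha> * r\<^sup>2 - \<alpha> * (norm v)\<^sup>2) * (real (card S) * exp (\<alpha> * (norm v)\<^sup>2))"
    using 1 by (intro mult_left_mono) auto
  also have "exp (- \<alpha> * r\<^sup>2 - \<alpha> * (norm v)\<^sup>2) * (real (card S) * exp (\<alpha> * (norm v)\<^sup>2)) =
      real (card S) * exp (- \<alpha> * r\<^sup>2)"
    by (simp flip: exp_add)
  finally show ?thesis .
qed


section \<open>Moments of spherical 2-designs\<close>

lemma polynomial_of_degree_le_monomial:
  assumes "(\<Sum>i\<in>UNIV. m i) \<le> M"
  shows "polynomial_of_degree_le M (\<lambda>x::real^'n. \<Prod>i\<in>UNIV. (x $ i) ^ m i)"
  unfolding polynomial_of_degree_le_def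
proof (intro exI ext)
  fix x :: "real^'n"
  have "(\<Sum>k | (\<Sum>i\<in>UNIV. k i) \<le> M. of_bool (k = m) * (\<Prod>i\<in>UNIV. (x $ i) ^ k i)) =
      (\<Sum>k\<in>{m}. of_bool (k = m) * (\<Prod>i\<in>UNIV. (x $ i) ^ k i))"
    using assms by (intro sum.mono_neutral_right finite_exponents_of_degree_le) auto
  then show "(\<Prod>i\<in>UNIV. (x $ i) ^ m i) =
      (\<Sum>k | (\<Sum>i\<in>UNIV. k i) \<le> M. of_bool (k = m) * (\<Prod>i\<in>UNIV. (x $ i) ^ k i))"
    by simp
qed

lemma polynomial_of_degree_le_add:
  assumes "polynomial_of_degree_le M p" "polynomial_of_degree_le M q"
  shows "polynomial_of_degree_le M (\<lambda>x. p x + q x)"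
proof -
  obtain a b where "p = (\<lambda>x. \<Sum>m | (\<Sum>i\<in>UNIV. m i) \<le> M. a m * (\<Prod>i\<in>UNIV. (x $ i) ^ m i))"
    "q = (\<lambda>x. \<Sum>m | (\<Sum>i\<in>UNIV. m i) \<le> M. b m * (\<Prod>i\<in>UNIV. (x $ i) ^ m i))"
    using assms unfolding polynomial_of_degree_le_def by blast
  then show ?thesis
    unfolding polynomial_of_degree_le_def
    by (intro exI[of _ "\<lambda>m. a m + b m"]) (simp add: sum.distrib algebra_simps)
qed

lemma polynomial_of_degree_le_cmult:
  assumes "polynomial_of_degree_le M p"
  shows "polynomial_of_degree_le M (\<lambda>x. k * p x)"
proof -
  obtain a where "p = (\<lambda>x. \<Sum>m | (\<Sum>i\<in>UNIV. m i) \<le> M. a m * (\<Prod>i\<in>UNIV. (x $ i) ^ m i))"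
    using assms unfolding polynomial_of_degree_le_def by blast
  then show ?thesis
    unfolding polynomial_of_degree_le_def
    by (intro exI[of _ "\<lambda>m. k * a m"]) (simp add: sum_distrib_left algebra_simps)
qed

lemma polynomial_of_degree_le_sum:
  assumes "finite I" "\<And>i. i \<in> I \<Longrightarrow> polynomial_of_degree_le M (p i)"
  shows "polynomial_of_degree_le M (\<lambda>x::real^'n. \<Sum>i\<in>I. p i x)"
  using assms
proof (induction rule: finite_induct)
  case empty
  have "polynomial_of_degree_le M (\<lambda>x::real^'n. 0 * (\<Prod>i\<in>UNIV. (x $ i) ^ 0))"
    by (intro polynomial_of_degree_le_cmult polynomial_of_degree_le_monomial) simp
  then show ?case by simp
qed (simp add: polynomial_of_degree_le_add)

lemma polynomial_of_degree_le_inner: "polynomial_of_degree_le 2 (\<lambda>x::real^'n. x \<bullet> v)"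
proof -
  have "polynomial_of_degree_le 2 (\<lambda>x::real^'n. x $ i)" for i
  proof -
    \<comment> \<open>The exponent vector of a coordinate is an indicator. The degree bound is 2
      rather than 1 because that is what the design condition tests.\<close>
    have "(\<Sum>j\<in>UNIV. of_bool (j = i) :: nat) \<le> 2" by simp
    from polynomial_of_degree_le_monomial[OF this] show ?thesis
      by (simp add: of_bool_def if_distrib cong: if_cong)
  qed
  then have "polynomial_of_degree_le 2 (\<lambda>x::real^'n. \<Sum>i\<in>UNIV. v $ i * x $ i)"
    by (intro polynomial_of_degree_le_sum polynomial_of_degree_le_cmult) auto
  then show ?thesis by (simp add: inner_vec_def mult.commute)
qed

lemma polynomial_of_degree_le_inner_square: "polynomial_of_degree_le 2 (\<lambda>x::real^'n. (x \<bullet> v)\<^sup>2)"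
proof -
  have *: "(\<Prod>k\<in>UNIV. (x $ k) ^ of_bool (k = i)) = x $ i" for x :: "real^'n" and i
    by (simp add: of_bool_def if_distrib cong: if_cong)
  have "polynomial_of_degree_le 2 (\<lambda>x::real^'n. x $ i * x $ j)" for i j
  proof -
    \<comment> \<open>Adding two indicators covers \<open>i = j\<close> and
      \<open>i \<noteq> j\<close> at once.\<close>
    have "(\<Sum>k\<in>UNIV. of_bool (k = i) + of_bool (k = j) :: nat) \<le> 2"
      by (simp add: sum.distrib)
    from polynomial_of_degree_le_monomial[OF this] show ?thesis
      by (simp add: power_add prod.distrib *)
  qed
  then have "polynomial_of_degree_le 2 (\<lambda>x::real^'n. \<Sum>i\<in>UNIV. \<Sum>j\<in>UNIV. (v $ i * v $ j) * (x $ i * x $ j))"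
    by (intro polynomial_of_degree_le_sum polynomial_of_degree_le_cmult) auto
  then show ?thesis
    by (simp add: inner_vec_def power2_eq_square sum_product mult_ac)
qed

section \<open>First and second moments of rotation-invariant probability measures\<close>

lemma integral_rotation_invariant:
  fixes \<omega> :: "(real^'n) measure"
  assumes \<omega>: "rotation_invariant_prob r \<omega>" and T: "orthogonal_transformation T"
    and f: "f \<in> borel_measurable borel"
  shows "(\<integral>y. f (T y) \<partial>\<omega>) = (\<integral>y. f y \<partial>\<omega> :: real)"
proof -
  have s: "sets \<omega> = sets borel" and d: "distr \<omega> borel T = \<omega>"
    using \<omega> T by (auto simp: rotation_invariant_prob_def)
  have "T \<in> \<omega> \<rightarrow>\<^sub>M borel"
    using orthogonal_measurable[OF T] by (simp add: measurable_cong_sets[OF s refl])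
  from integral_distr[OF this f] show ?thesis by (simp add: d)
qed

text \<open>The antipodal map is orthogonal, so the integral equals its own negative.\<close>

lemma integral_inner_rotation_invariant:
  fixes \<omega> :: "(real^'n) measure"
  assumes \<omega>: "rotation_invariant_prob r \<omega>"
  shows "(\<integral>y. y \<bullet> v \<partial>\<omega>) = 0"
proof -
  have "(\<integral>y. (- y) \<bullet> v \<partial>\<omega>) = (\<integral>y. y \<bullet> v \<partial>\<omega>)"
    by (rule integral_rotation_invariant[OF \<omega>, where f="\<lambda>y. y \<bullet> v" and T=uminus])
      (auto simp: orthogonal_transformation_def linear_uminus intro: borel_measurable_continuous_onI continuous_intros)
  then show ?thesis by simp
qed

text \<open>An orthogonal map carries \<open>v\<close> to \<open>norm v *\<^sub>R b\<close> for any
  basis vector \<open>b\<close>, so all coordinates have the same second moment; these add up to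
  \<open>r\<^sup>2\<close>, because \<open>norm y = r\<close> almost surely.\<close>

lemma integral_inner_square_rotation_invariant:
  fixes \<omega> :: "(real^'n) measure"
  assumes \<omega>: "rotation_invariant_prob r \<omega>"
  shows "(\<integral>y. (y \<bullet> v)\<^sup>2 \<partial>\<omega>) = (r * norm v)\<^sup>2 / real CARD('n)"
proof -
  have s: "sets \<omega> = sets borel" and AE: "AE x in \<omega>. x \<in> sphere 0 r" and ps: "prob_space \<omega>"
    using \<omega> by (auto simp: rotation_invariant_prob_def)
  interpret prob_space \<omega> by fact
  have meas: "(\<lambda>y. (y \<bullet> w)\<^sup>2) \<in> borel_measurable borel" for w :: "real^'n"
    by (intro borel_measurable_continuous_onI continuous_intros)
  \<comment> \<open>Integrability justifies exchanging the integral with the sum over the basis; on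
    the sphere Cauchy-Schwarz bounds the integrand.\<close>
  have int: "integrable \<omega> (\<lambda>y. (y \<bullet> w)\<^sup>2)" for w
  proof (rule integrable_const_bound[where B="(r * norm w)\<^sup>2"])
    show "AE x in \<omega>. norm ((x \<bullet> w)\<^sup>2) \<le> (r * norm w)\<^sup>2"
      using AE
    proof eventually_elim
      case (elim x)
      then have "\<bar>x \<bullet> w\<bar> \<le> r * norm w"
        using Cauchy_Schwarz_ineq2[of x w] by simp
      then show ?case by (simp add: power2_le_iff_abs_le)
    qed
    show "(\<lambda>x. (x \<bullet> w)\<^sup>2) \<in> borel_measurable \<omega>"
      using meas by (simp add: measurable_cong_sets[OF s refl])
  qed
  have eq: "(\<integral>y. (y \<bullet> b)\<^sup>2 \<partial>\<omega>) * (norm v)\<^sup>2 = (\<integral>y. (y \<bullet> v)\<^sup>2 \<partial>\<omega>)" if "b \<in> Basis" for b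
  proof -
    have "norm v = norm (norm v *\<^sub>R b)" using that by simp
    then obtain T where T: "orthogonal_transformation T" "T v = norm v *\<^sub>R b"
      using orthogonal_transformation_exists by blast
    have "(\<integral>y. (y \<bullet> v)\<^sup>2 \<partial>\<omega>) = (\<integral>y. (T y \<bullet> T v)\<^sup>2 \<partial>\<omega>)"
      using T(1) by (simp add: orthogonal_transformation_def)
    also have "\<dots> = (\<integral>y. (y \<bullet> T v)\<^sup>2 \<partial>\<omega>)"
      by (rule integral_rotation_invariant[OF \<omega> T(1), where f="\<lambda>y. (y \<bullet> T v)\<^sup>2"]) (rule meas)
    also have "\<dots> = (\<integral>y. (norm v)\<^sup>2 * (y \<bullet> b)\<^sup>2 \<partial>\<omega>)"
      by (simp add: T(2) power_mult_distrib)
    finally show ?thesis by simp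
  qed
  have "real CARD('n) * (\<integral>y. (y \<bullet> v)\<^sup>2 \<partial>\<omega>) = (\<Sum>b\<in>(Basis::(real^'n) set). (\<integral>y. (y \<bullet> b)\<^sup>2 \<partial>\<omega>) * (norm v)\<^sup>2)"
    by (simp add: eq)
  also have "\<dots> = (\<integral>y. (\<Sum>b\<in>(Basis::(real^'n) set). (y \<bullet> b)\<^sup>2) \<partial>\<omega>) * (norm v)\<^sup>2"
    by (simp add: int Bochner_Integration.integral_sum sum_distrib_right)
  also have "(\<integral>y. (\<Sum>b\<in>(Basis::(real^'n) set). (y \<bullet> b)\<^sup>2) \<partial>\<omega>) = (\<integral>y. r\<^sup>2 \<partial>\<omega>)"
  proof (rule integral_cong_AE)
    show "AE y in \<omega>. (\<Sum>b\<in>(Basis::(real^'n) set). (y \<bullet> b)\<^sup>2) = r\<^sup>2"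
      using AE
    proof eventually_elim
      case (elim y)
      have "(\<Sum>b\<in>(Basis::(real^'n) set). (y \<bullet> b)\<^sup>2) = (norm y)\<^sup>2"
        by (subst power2_norm_eq_inner, subst euclidean_inner) (simp add: power2_eq_square)
      then show ?case using elim by simp
    qed
  qed (use int in auto)
  finally show ?thesis
    by (simp add: prob_space power_mult_distrib field_simps)
qed

lemma spherical_design_moments:
  fixes X :: "(real^'n) set"
  assumes X: "spherical_design 2 c r X"
  shows "(\<Sum>x\<in>X. (x - c) \<bullet> v) = 0"
    and "(\<Sum>x\<in>X. ((x - c) \<bullet> v)\<^sup>2) = real (card X) * ((r * norm v)\<^sup>2 / real CARD('n))"
proof -
  have fin: "finite X" "X \<noteq> {}" "X \<subseteq> sphere c r"
    and avg: "\<And>q. polynomial_of_degree_le 2 q \<Longrightarrow>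
        (\<integral>y. q y \<partial>sphere_prob r) = (\<Sum>x\<in>X. q (x - c)) / real (card X)"
    using X by (auto simp: spherical_design_def)
  have card: "real (card X) \<noteq> 0" using fin by simp
  \<comment> \<open>A point of \<open>X\<close> lies on the sphere, which excludes negative
    \<open>r\<close>, for which \<open>sphere_prob\<close> would not be meaningful.\<close>
  have "0 \<le> r" using fin by (auto simp: subset_iff)
  then have \<omega>: "rotation_invariant_prob r (sphere_prob r :: (real^'n) measure)"
    by (rule rotation_invariant_prob_sphere_prob)
  show "(\<Sum>x\<in>X. (x - c) \<bullet> v) = 0"
    using avg[OF polynomial_of_degree_le_inner[of v]] card
    by (simp add: integral_inner_rotation_invariant[OF \<omega>])
  show "(\<Sum>x\<in>X. ((x - c) \<bullet> v)\<^sup>2) = real (card X) * ((r * norm v)\<^sup>2 / real CARD('n))"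
    using avg[OF polynomial_of_degree_le_inner_square[of v]] card
    unfolding integral_inner_square_rotation_invariant[OF \<omega>] by (simp add: field_simps)
qed


section \<open>Lattice coordinates and convergence\<close>

text \<open>Membership as integrality of the coordinates, which are linear in the point: closure
  under subtraction and distance estimates then follow coordinatewise.\<close>

lemma full_lattice_coordinates:
  fixes L :: "(real^'n) set"
  assumes "full_lattice L"
  obtains B where "independent B" "span B = UNIV" "finite B"
    "\<And>x. x \<in> L \<longleftrightarrow> (\<forall>b\<in>B. representation B x b \<in> \<int>)"
proof -
  obtain B where B: "independent B" "span B = UNIV"
    and L: "L = range (\<lambda>k :: real^'n \<Rightarrow> int. \<Sum>b\<in>B. of_int (k b) *\<^sub>R b)"
    using assms unfolding full_lattice_def by blast
  have fin: "finite B" using B(1) by (rule independent_imp_finite)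
  have "x \<in> L \<longleftrightarrow> (\<forall>b\<in>B. representation B x b \<in> \<int>)" for x
  proof
    assume "x \<in> L"
    then obtain k :: "real^'n \<Rightarrow> int" where k: "x = (\<Sum>b\<in>B. of_int (k b) *\<^sub>R b)"
      unfolding L by blast
    show "\<forall>b\<in>B. representation B x b \<in> \<int>"
    proof
      fix b assume "b \<in> B"
      then have "representation B x b = (\<Sum>a\<in>B. of_int (k a) * (if b = a then 1 else 0))"
        unfolding k using B
        by (simp add: representation_sum representation_scale representation_basis)
      also have "\<dots> = of_int (k b)"
        using \<open>b \<in> B\<close> fin by (simp add: if_distrib[of "(*) _"] cong: if_cong)
      finally show "representation B x b \<in> \<int>" by simp
    qed
  next
    assume int: "\<forall>b\<in>B. representation B x b \<in> \<int>"
    have "x = (\<Sum>b\<in>B. representation B x b *\<^sub>R b)"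
      using B fin by (intro sum_representation_eq[symmetric]) auto
    also have "\<dots> = (\<Sum>b\<in>B. of_int \<lfloor>representation B x b\<rfloor> *\<^sub>R b)"
      using int by (intro sum.cong) auto
    finally show "x \<in> L"
      unfolding L by (rule range_eqI[of _ _ "\<lambda>b. \<lfloor>representation B x b\<rfloor>"])
  qed
  with B fin that show thesis by blast
qed

lemma sum_abs_representation_le:
  fixes B :: "'a::euclidean_space set"
  assumes B: "independent B" "span B = UNIV"
  obtains K where "0 < K" "\<And>x. (\<Sum>b\<in>B. \<bar>representation B x b\<bar>) \<le> K * norm x"
proof -
  have "\<exists>K. 0 < K \<and> (\<forall>x. \<bar>representation B x b\<bar> \<le> norm x * K)" for b
    using bounded_linear.pos_bounded[OF bounded_linear_representation[OF B]] by simp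
  then obtain K where K: "\<And>b. 0 < K b" "\<And>b x. \<bar>representation B x b\<bar> \<le> norm x * K b"
    by metis
  \<comment> \<open>The added 1 makes the constant positive without an appeal to
    \<open>B \<noteq> {}\<close>.\<close>
  have "(\<Sum>b\<in>B. \<bar>representation B x b\<bar>) \<le> ((\<Sum>b\<in>B. K b) + 1) * norm x" for x
  proof -
    have "(\<Sum>b\<in>B. \<bar>representation B x b\<bar>) \<le> (\<Sum>b\<in>B. norm x * K b)"
      by (intro sum_mono K)
    also have "\<dots> \<le> ((\<Sum>b\<in>B. K b) + 1) * norm x"
      by (simp add: sum_distrib_left algebra_simps)
    finally show ?thesis .
  qed
  moreover have "0 < (\<Sum>b\<in>B. K b) + 1"
    using K(1) by (intro add_nonneg_pos sum_nonneg) (auto intro: less_imp_le)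
  ultimately show thesis using that by blast
qed

lemma full_lattice_diff:
  assumes "full_lattice L" "x \<in> L" "y \<in> L"
  shows "x - y \<in> L"
proof -
  obtain B where "independent B" "span B = UNIV"
    "\<And>x. x \<in> L \<longleftrightarrow> (\<forall>b\<in>B. representation B x b \<in> \<int>)"
    using full_lattice_coordinates[OF assms(1)] by metis
  then show ?thesis using assms(2,3) by (simp add: representation_diff)
qed

lemma full_lattice_zero: "full_lattice L \<Longrightarrow> 0 \<in> L"
  unfolding full_lattice_def by (auto intro!: range_eqI[of _ _ "\<lambda>_. 0"])

lemma full_lattice_image_translation:
  assumes L: "full_lattice L" and l: "l \<in> L"
  shows "(\<lambda>x. x - l) ` L = L"
proof
  show "(\<lambda>x. x - l) ` L \<subseteq> L" using full_lattice_diff[OF L _ l] by auto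
  show "L \<subseteq> (\<lambda>x. x - l) ` L"
  proof
    fix x assume "x \<in> L"
    then have "x - (0 - l) \<in> L"
      by (intro full_lattice_diff[OF L] l full_lattice_zero[OF L])
    then show "x \<in> (\<lambda>x. x - l) ` L" by (intro image_eqI[of _ _ "x + l"]) auto
  qed
qed

text \<open>Rounding every coordinate down gives a lattice point; the error has coordinates in [0,
  1), so the norms of the basis vectors bound it.\<close>

lemma full_lattice_cobounded:
  fixes L :: "(real^'n) set"
  assumes "full_lattice L"
  obtains R where "\<And>z. \<exists>l\<in>L. norm (z - l) \<le> R"
proof -
  obtain B where B: "independent B" "span B = UNIV"
    and L: "L = range (\<lambda>k :: real^'n \<Rightarrow> int. \<Sum>b\<in>B. of_int (k b) *\<^sub>R b)"
    using assms unfolding full_lattice_def by blast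
  have fin: "finite B" using B(1) by (rule independent_imp_finite)
  have "\<exists>l\<in>L. norm (z - l) \<le> (\<Sum>b\<in>B. norm b)" for z
  proof
    let ?l = "\<Sum>b\<in>B. of_int \<lfloor>representation B z b\<rfloor> *\<^sub>R b"
    show "?l \<in> L"
      unfolding L by (rule range_eqI[of _ _ "\<lambda>b. \<lfloor>representation B z b\<rfloor>"]) simp
    have "z = (\<Sum>b\<in>B. representation B z b *\<^sub>R b)"
      using B fin by (intro sum_representation_eq[symmetric]) auto
    then have "norm (z - ?l) = norm (\<Sum>b\<in>B. frac (representation B z b) *\<^sub>R b)"
      by (simp add: frac_def scaleR_left_diff_distrib sum_subtractf)
    also have "\<dots> \<le> (\<Sum>b\<in>B. norm b)"
      by (intro sum_norm_le)
        (simp add: frac_ge_0 frac_lt_1 less_imp_le mult_left_le_one_le)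
    finally show "norm (z - ?l) \<le> (\<Sum>b\<in>B. norm b)" .
  qed
  then show thesis by (rule that)
qed

text \<open>This makes the covering radius positive. Half a basis vector has a coordinate at
  distance at least 1/2 from every integer, and coordinates are controlled by the norm.\<close>

lemma infdist_full_lattice_pos:
  fixes L :: "(real^'n) set"
  assumes "full_lattice L"
  obtains z where "0 < infdist z L"
proof -
  obtain B where B: "independent B" "span B = UNIV" "finite B"
    and L: "\<And>x. x \<in> L \<longleftrightarrow> (\<forall>b\<in>B. representation B x b \<in> \<int>)"
    using full_lattice_coordinates[OF assms] by metis
  obtain K where K: "0 < K" "\<And>x. (\<Sum>b\<in>B. \<bar>representation B x b\<bar>) \<le> K * norm x"
    using sum_abs_representation_le[OF B(1,2)] by metis
  have "B \<noteq> {}"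
  proof
    assume "B = {}"
    then have "axis undefined 1 = (0::real^'n)" using B(2) by auto
    then show False by (simp add: axis_eq_0_iff)
  qed
  then obtain b where b: "b \<in> B" by blast
  let ?z = "(1/2) *\<^sub>R b"
  have "1 / (2 * K) \<le> dist ?z x" if "x \<in> L" for x
  proof -
    obtain k where k: "representation B x b = of_int k"
      using L[of x] \<open>x \<in> L\<close> b by (meson Ints_cases)
    have "representation B (?z - x) b = 1 / 2 - of_int k"
      using B(1,2) b k by (simp add: representation_diff representation_scale representation_basis)
    moreover have "\<bar>1 / 2 - real_of_int k\<bar> \<ge> 1 / 2"
      by (cases "k \<le> 0") auto
    ultimately have "1 / 2 \<le> (\<Sum>b\<in>B. \<bar>representation B (?z - x) b\<bar>)"
      using member_le_sum[OF b, of "\<lambda>b. \<bar>representation B (?z - x) b\<bar>"] B(3) by simp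
    also have "\<dots> \<le> K * dist ?z x" unfolding dist_norm by (rule K)
    finally show ?thesis using K(1) by (simp add: field_simps)
  qed
  then have "1 / (2 * K) \<le> infdist ?z L"
    using full_lattice_zero[OF assms] by (auto simp: infdist_def intro!: cINF_greatest)
  moreover have "0 < 1 / (2 * K)" using K(1) by simp
  ultimately show thesis using that less_le_trans by blast
qed

section \<open>Convergence of Gaussian sums over a lattice\<close>

lemma sum_exp_abs_int_bounded:
  fixes \<beta> :: real
  assumes "0 < \<beta>"
  obtains C where "\<And>T. finite T \<Longrightarrow> (\<Sum>j\<in>T. exp (- \<beta> * \<bar>real_of_int j\<bar>)) \<le> C"
proof -
  define q where "q = exp (- \<beta>)"
  have q: "0 \<le> q" "q < 1" using assms by (auto simp: q_def)
  have pow: "exp (- \<beta> * real n) = q ^ n" for n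
    by (simp add: q_def exp_of_nat_mult[symmetric] mult.commute)
  have sm: "summable (\<lambda>n. q ^ n)" using q by (intro summable_geometric) simp
  \<comment> \<open>Nonnegative and negative integers are treated separately, since the absolute
    value is injective on each; both halves embed in one geometric series.\<close>
  have half: "(\<Sum>j\<in>T. exp (- \<beta> * \<bar>real_of_int j\<bar>)) \<le> (\<Sum>n. q ^ n)"
    if "finite T" "inj_on (nat \<circ> abs) T" for T :: "int set"
  proof -
    have "(\<Sum>j\<in>T. exp (- \<beta> * \<bar>real_of_int j\<bar>)) = (\<Sum>j\<in>T. q ^ (nat \<circ> abs) j)"
      by (intro sum.cong) (auto simp flip: pow)
    also have "\<dots> = (\<Sum>n\<in>(nat \<circ> abs) ` T. q ^ n)"
      using that(2) by (subst sum.reindex) (auto simp: o_def)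
    also have "\<dots> \<le> (\<Sum>n. q ^ n)"
      using that(1) q by (intro sum_le_suminf sm) auto
    finally show ?thesis .
  qed
  have "(\<Sum>j\<in>T. exp (- \<beta> * \<bar>real_of_int j\<bar>)) \<le> 2 * (\<Sum>n. q ^ n)" if "finite T" for T
  proof -
    have "(\<Sum>j\<in>T. exp (- \<beta> * \<bar>real_of_int j\<bar>)) =
        (\<Sum>j\<in>T \<inter> {0..}. exp (- \<beta> * \<bar>real_of_int j\<bar>)) + (\<Sum>j\<in>T \<inter> {..<0}. exp (- \<beta> * \<bar>real_of_int j\<bar>))"
      using that by (subst sum.union_disjoint[symmetric]) (auto intro!: sum.cong)
    also have "\<dots> \<le> (\<Sum>n. q ^ n) + (\<Sum>n. q ^ n)"
      using that by (intro add_mono half) (auto simp: inj_on_def)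
    finally show ?thesis by simp
  qed
  then show thesis by (rule that)
qed

text \<open>The Gaussian is dominated by an exponential in the sum of the absolute coordinates,
  which factors over the basis. Finite sums are thus bounded by a product of one-dimensional
  sums.\<close>

lemma gaussian_summable_on_full_lattice:
  fixes L :: "(real^'n) set"
  assumes lat: "full_lattice L" and \<alpha>: "0 < \<alpha>"
  shows "(\<lambda>x. exp (- \<alpha> * (norm (x - z))\<^sup>2)) summable_on L"
proof (rule nonneg_bdd_above_summable_on)
  obtain B where B: "independent B" "span B = UNIV" "finite B"
    and L: "\<And>x. x \<in> L \<longleftrightarrow> (\<forall>b\<in>B. representation B x b \<in> \<int>)"
    using full_lattice_coordinates[OF lat] by metis
  obtain K where K: "0 < K" "\<And>x. (\<Sum>b\<in>B. \<bar>representation B x b\<bar>) \<le> K * norm x"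
    using sum_abs_representation_le[OF B(1,2)] by metis
  define \<beta> where "\<beta> = \<alpha> / K"
  have \<beta>: "0 < \<beta>" using \<alpha> K by (simp add: \<beta>_def)
  obtain C where C: "\<And>T. finite T \<Longrightarrow> (\<Sum>j\<in>T. exp (- \<beta> * \<bar>real_of_int j\<bar>)) \<le> C"
    using sum_exp_abs_int_bounded[OF \<beta>] by metis
  \<comment> \<open>Restricting to \<open>B\<close> makes the coordinate vectors extensional, hence
    members of a finite box \<open>B \<rightarrow>\<^sub>E T\<close>.\<close>
  define \<phi> where "\<phi> x = (\<lambda>b\<in>B. \<lfloor>representation B x b\<rfloor>)" for x
  have rep: "representation B x b = of_int (\<phi> x b)" if "x \<in> L" "b \<in> B" for x b
    using that L by (auto simp: \<phi>_def)
  have inj: "inj_on \<phi> L"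
  proof
    fix x y assume xy: "x \<in> L" "y \<in> L" "\<phi> x = \<phi> y"
    have "x = (\<Sum>b\<in>B. representation B x b *\<^sub>R b)" "y = (\<Sum>b\<in>B. representation B y b *\<^sub>R b)"
      using B by (auto intro!: sum_representation_eq[symmetric])
    moreover have "(\<Sum>b\<in>B. representation B x b *\<^sub>R b) = (\<Sum>b\<in>B. representation B y b *\<^sub>R b)"
      using xy by (intro sum.cong) (simp_all add: rep)
    ultimately show "x = y" by simp
  qed
  let ?g = "\<lambda>k. \<Prod>b\<in>B. exp (- \<beta> * \<bar>real_of_int (k b)\<bar>)"
  have pt: "exp (- \<alpha> * (norm (x - z))\<^sup>2) \<le> exp (\<alpha> * (norm z + 1)) * ?g (\<phi> x)" if "x \<in> L" for x
  proof -
    \<comment> \<open>Completing the square trades the quadratic exponent for a linear one, at the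
      cost of a constant.\<close>
    have "0 \<le> (norm (x - z) - 1 / 2)\<^sup>2" by simp
    then have "norm (x - z) - 1 \<le> (norm (x - z))\<^sup>2"
      by (simp add: power2_eq_square algebra_simps)
    moreover have "norm x - norm z \<le> norm (x - z)" by (rule norm_triangle_ineq2)
    moreover have "(\<Sum>b\<in>B. \<bar>real_of_int (\<phi> x b)\<bar>) / K \<le> norm x"
      using K that by (simp add: rep[symmetric] field_simps)
    ultimately have "(\<Sum>b\<in>B. \<bar>real_of_int (\<phi> x b)\<bar>) / K - (norm z + 1) \<le> (norm (x - z))\<^sup>2"
      by linarith
    then have "\<alpha> * ((\<Sum>b\<in>B. \<bar>real_of_int (\<phi> x b)\<bar>) / K - (norm z + 1)) \<le> \<alpha> * (norm (x - z))\<^sup>2"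
      using \<alpha> by (intro mult_left_mono) auto
    then have "- \<alpha> * (norm (x - z))\<^sup>2 \<le> \<alpha> * (norm z + 1) + (\<Sum>b\<in>B. - \<beta> * \<bar>real_of_int (\<phi> x b)\<bar>)"
      by (simp add: \<beta>_def sum_negf algebra_simps sum_divide_distrib sum_distrib_left)
    then have "exp (- \<alpha> * (norm (x - z))\<^sup>2) \<le> exp (\<alpha> * (norm z + 1) + (\<Sum>b\<in>B. - \<beta> * \<bar>real_of_int (\<phi> x b)\<bar>))"
      by simp
    then show ?thesis using B(3) by (simp only: exp_add exp_sum)
  qed
  show "bdd_above (sum (\<lambda>x. exp (- \<alpha> * (norm (x - z))\<^sup>2)) ` {F. F \<subseteq> L \<and> finite F})"
  proof (rule bdd_aboveI2)
    fix F assume "F \<in> {F. F \<subseteq> L \<and> finite F}"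
    then have F: "F \<subseteq> L" "finite F" by auto
    \<comment> \<open>All coordinates occurring in \<open>F\<close>: the image of \<open>F\<close>
      lies in the box over \<open>T\<close>, and the sum over the full box factors.\<close>
    define T where "T = (\<Union>x\<in>F. \<phi> x ` B)"
    have T: "finite T" using F B by (simp add: T_def)
    have "(\<Sum>x\<in>F. exp (- \<alpha> * (norm (x - z))\<^sup>2)) \<le> (\<Sum>x\<in>F. exp (\<alpha> * (norm z + 1)) * ?g (\<phi> x))"
      using F by (intro sum_mono pt) auto
    also have "\<dots> = exp (\<alpha> * (norm z + 1)) * (\<Sum>k\<in>\<phi> ` F. ?g k)"
      using inj_on_subset[OF inj F(1)] by (simp add: sum.reindex sum_distrib_left)
    also have "(\<Sum>k\<in>\<phi> ` F. ?g k) \<le> (\<Sum>k\<in>B \<rightarrow>\<^sub>E T. ?g k)"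
      using B(3) T by (intro sum_mono2 finite_PiE prod_nonneg) (auto simp: \<phi>_def T_def)
    also have "\<dots> = (\<Prod>b\<in>B. \<Sum>j\<in>T. exp (- \<beta> * \<bar>real_of_int j\<bar>))"
      using B(3) T by (subst prod_sum_PiE) auto
    also have "\<dots> \<le> (\<Prod>b\<in>B. C)"
      using C[OF T] by (intro prod_mono) (auto intro: sum_nonneg)
    finally show "(\<Sum>x\<in>F. exp (- \<alpha> * (norm (x - z))\<^sup>2)) \<le> exp (\<alpha> * (norm z + 1)) * (\<Prod>b\<in>B. C)"
      by (simp add: mult_left_mono)
  qed
qed simp


section \<open>Comparing Gaussian sums\<close>

lemma gaussian_sum_affine_isometry:
  assumes f: "affine_isometry f" "f ` L = L"
  shows "gaussian_sum L \<alpha> (f z) = gaussian_sum L \<alpha> z"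
proof -
  have norm: "norm (f x - f y) = norm (x - y)" for x y
  proof -
    obtain T b where T: "orthogonal_transformation T" "f = (\<lambda>x. T x + b)"
      using f(1) unfolding affine_isometry_def by blast
    have "f x - f y = T (x - y)"
      by (simp add: T(2) linear_diff[OF orthogonal_transformation_linear[OF T(1)]])
    then show ?thesis by (simp add: orthogonal_transformation_norm[OF T(1)])
  qed
  have "inj_on f L"
    by (rule inj_onI) (metis norm norm_eq_zero right_minus_eq)
  then have "bij_betw f L L" using f(2) by (simp add: bij_betw_def)
  from infsum_reindex_bij_betw[OF this, of "\<lambda>x. exp (- \<alpha> * (norm (x - f z))\<^sup>2)"]
  show ?thesis by (simp add: gaussian_sum_def norm)
qed

text \<open>Any finite set of lattice points is contained in a finite union of complete shells.
  These are disjoint and all terms are nonnegative, so the shellwise comparison bounds each partial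
  sum at \<open>c\<close> by the whole sum at \<open>z\<close>.\<close>

lemma gaussian_sum_le_by_shells:
  assumes lat: "full_lattice L" and \<alpha>: "0 < \<alpha>"
    and fin: "\<And>r. finite (shell L c r)"
    and le: "\<And>r. shell L c r \<noteq> {} \<Longrightarrow>
      real (card (shell L c r)) * exp (- \<alpha> * r\<^sup>2) \<le> (\<Sum>x\<in>shell L c r. exp (- \<alpha> * (norm (x - z))\<^sup>2))"
  shows "gaussian_sum L \<alpha> c \<le> gaussian_sum L \<alpha> z"
  unfolding gaussian_sum_def
proof (rule infsum_le_finite_sums)
  fix F assume F: "finite F" "F \<subseteq> L"
  let ?N = "(\<lambda>x. norm (x - c)) ` F"
  let ?G = "\<Union>r\<in>?N. shell L c r"
  have G: "finite ?G" "F \<subseteq> ?G" "?G \<subseteq> L"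
    using F fin by (auto simp: shell_def)
  have disj: "\<forall>r\<in>?N. \<forall>s\<in>?N. r \<noteq> s \<longrightarrow> shell L c r \<inter> shell L c s = {}"
    by (auto simp: shell_def)
  have "(\<Sum>x\<in>F. exp (- \<alpha> * (norm (x - c))\<^sup>2)) \<le> (\<Sum>x\<in>?G. exp (- \<alpha> * (norm (x - c))\<^sup>2))"
    using G by (intro sum_mono2) auto
  also have "\<dots> = (\<Sum>r\<in>?N. \<Sum>x\<in>shell L c r. exp (- \<alpha> * (norm (x - c))\<^sup>2))"
    using F fin disj by (intro sum.UNION_disjoint) auto
  also have "\<dots> = (\<Sum>r\<in>?N. real (card (shell L c r)) * exp (- \<alpha> * r\<^sup>2))"
    by (intro sum.cong) (auto simp: shell_def)
  also have "\<dots> \<le> (\<Sum>r\<in>?N. \<Sum>x\<in>shell L c r. exp (- \<alpha> * (norm (x - z))\<^sup>2))"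
    using F by (intro sum_mono le) (auto simp: shell_def)
  also have "\<dots> = (\<Sum>x\<in>?G. exp (- \<alpha> * (norm (x - z))\<^sup>2))"
    using F fin disj by (intro sum.UNION_disjoint[symmetric]) auto
  also have "\<dots> \<le> (\<Sum>\<^sub>\<infinity>x\<in>L. exp (- \<alpha> * (norm (x - z))\<^sup>2))"
    using G by (intro finite_sum_le_infsum gaussian_summable_on_full_lattice lat \<alpha>) auto
  finally show "(\<Sum>x\<in>F. exp (- \<alpha> * (norm (x - c))\<^sup>2)) \<le> (\<Sum>\<^sub>\<infinity>x\<in>L. exp (- \<alpha> * (norm (x - z))\<^sup>2))" .
qed (rule gaussian_summable_on_full_lattice[OF lat \<alpha>])

text \<open>One unit of \<open>\<alpha>\<close> is kept for convergence; in the remaining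
  \<open>\<alpha> - 1\<close> every distance is replaced by the smallest one.\<close>

lemma gaussian_sum_upper_bound:
  assumes lat: "full_lattice L" and \<alpha>: "1 \<le> \<alpha>"
  shows "gaussian_sum L \<alpha> c \<le> exp (- (\<alpha> - 1) * (infdist c L)\<^sup>2) * gaussian_sum L 1 c"
proof -
  have "gaussian_sum L \<alpha> c \<le> (\<Sum>\<^sub>\<infinity>x\<in>L. exp (- (\<alpha> - 1) * (infdist c L)\<^sup>2) * exp (- 1 * (norm (x - c))\<^sup>2))"
    unfolding gaussian_sum_def
  proof (rule infsum_mono)
    show "exp (- \<alpha> * (norm (x - c))\<^sup>2) \<le> exp (- (\<alpha> - 1) * (infdist c L)\<^sup>2) * exp (- 1 * (norm (x - c))\<^sup>2)"
      if "x \<in> L" for x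
    proof -
      from that have "(infdist c L)\<^sup>2 \<le> (norm (x - c))\<^sup>2"
        using infdist_le[of x L c] infdist_nonneg[of c L]
        by (intro power_mono) (auto simp: dist_norm norm_minus_commute)
      then have "(\<alpha> - 1) * (infdist c L)\<^sup>2 \<le> (\<alpha> - 1) * (norm (x - c))\<^sup>2"
        using \<alpha> by (intro mult_left_mono) auto
      then show ?thesis
        by (simp add: algebra_simps flip: exp_add)
    qed
    show "(\<lambda>x. exp (- \<alpha> * (norm (x - c))\<^sup>2)) summable_on L"
      using \<alpha> by (intro gaussian_summable_on_full_lattice lat) simp
    show "(\<lambda>x. exp (- (\<alpha> - 1) * (infdist c L)\<^sup>2) * exp (- 1 * (norm (x - c))\<^sup>2)) summable_on L"
      by (intro summable_on_cmult_right gaussian_summable_on_full_lattice lat) simp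
  qed
  also have "\<dots> = exp (- (\<alpha> - 1) * (infdist c L)\<^sup>2) * gaussian_sum L 1 c"
    unfolding gaussian_sum_def by (rule infsum_cmult_right')
  finally show ?thesis .
qed

text \<open>A single lattice point closer than \<open>m\<close> suffices; the strict hypothesis
  supplies it without using that the infimum is attained.\<close>

lemma gaussian_sum_lower_bound:
  assumes lat: "full_lattice L" and \<alpha>: "0 < \<alpha>" and m: "infdist z L < m"
  shows "exp (- \<alpha> * m\<^sup>2) \<le> gaussian_sum L \<alpha> z"
proof -
  have "bdd_below (dist z ` L)" by (intro bdd_belowI2[of _ 0]) simp
  then obtain x where x: "x \<in> L" "dist z x < m"
    using m full_lattice_zero[OF lat] by (auto simp: infdist_def cINF_less_iff split: if_splits)
  then have "(norm (x - z))\<^sup>2 \<le> m\<^sup>2"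
    by (intro power_mono) (auto simp: dist_norm norm_minus_commute)
  then have "exp (- \<alpha> * m\<^sup>2) \<le> (\<Sum>x\<in>{x}. exp (- \<alpha> * (norm (x - z))\<^sup>2))"
    using \<alpha> by simp
  also have "\<dots> \<le> gaussian_sum L \<alpha> z"
    unfolding gaussian_sum_def
    using x by (intro finite_sum_le_infsum gaussian_summable_on_full_lattice lat \<alpha>) auto
  finally show ?thesis .
qed

section \<open>Minimality of the deep hole for large \<alpha>\<close>

theorem theorem1p2:
  fixes L :: "(real^'n) set" and c :: "real^'n"
  assumes "full_lattice L"
    and "deep_hole L c"
    and "\<And>c'. deep_hole L c' \<Longrightarrow> \<exists>f. affine_isometry f \<and> f ` L = L \<and> f c = c'"
    and "\<And>r. shell L c r \<noteq> {} \<Longrightarrow> spherical_design 2 c r (shell L c r)"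
  shows "stable_cold_spot L c"
proof -
  note lat = assms(1)
  define \<mu> where "\<mu> = infdist c L"
  have \<mu>_max: "infdist z L \<le> \<mu>" for z
    using assms(2) by (simp add: deep_hole_def \<mu>_def)
  have \<mu>: "0 < \<mu>"
    using infdist_full_lattice_pos[OF lat] \<mu>_max by (meson less_le_trans)
  txt \<open>In dimension \<open>n\<close> the variance is \<open>(r|v|)\<^sup>2 / n\<close>; weakening \<open>n\<close> to \<open>n + 1\<close> ensures \<open>N > 1\<close>, which the
    exponential bound requires, also for \<open>n = 1\<close>.\<close>
  define N where "N = real CARD('n) + 1"
  have N: "1 < N" "real CARD('n) \<le> N" by (auto simp: N_def)
  \<comment> \<open>Both \<open>\<delta>\<close> and \<open>\<alpha>1\<close> are the thresholds of
    \<open>sum_gaussian_ge_of_moments\<close> at \<open>r = \<mu>\<close>, a lower bound for the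
    radii of all non-empty shells around \<open>c\<close>.\<close>
  define \<delta> where "\<delta> = \<mu> / N"
  have \<delta>: "0 < \<delta>" using \<mu> N by (simp add: \<delta>_def)
  define \<alpha>1 where "\<alpha>1 = N\<^sup>2 / (\<mu>\<^sup>2 * (N - 1))"
  have \<alpha>1: "0 < \<alpha>1" using \<mu> N by (simp add: \<alpha>1_def)

  have near_c: "gaussian_sum L \<alpha> c \<le> gaussian_sum L \<alpha> z" if \<alpha>: "\<alpha>1 \<le> \<alpha>" and z: "norm (z - c) < \<delta>" for \<alpha> z
  proof (rule gaussian_sum_le_by_shells[OF lat])
    show \<alpha>0: "0 < \<alpha>" using \<alpha> \<alpha>1 by linarith
    show "finite (shell L c r)" for r
      using assms(4)[of r] by (cases "shell L c r = {}") (auto simp: spherical_design_def)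
    fix r assume ne: "shell L c r \<noteq> {}"
    then have r: "\<mu> \<le> r"
      using infdist_le[of _ L c] by (auto simp: shell_def \<mu>_def dist_norm norm_minus_commute)
    note mom = spherical_design_moments[OF assms(4)[OF ne], of "z - c"]
    have "real (card (shell L c r)) * exp (- \<alpha> * r\<^sup>2) \<le>
        (\<Sum>x\<in>shell L c r. exp (- \<alpha> * (norm (x - (c + (z - c))))\<^sup>2))"
    proof (rule sum_gaussian_ge_of_moments[OF _ mom(1) _ N(1) _ _ \<alpha>0])
      show "norm (x - c) = r" if "x \<in> shell L c r" for x using that by (simp add: shell_def)
      show "real (card (shell L c r)) * ((r * norm (z - c))\<^sup>2 / N) \<le> (\<Sum>x\<in>shell L c r. ((x - c) \<bullet> (z - c))\<^sup>2)"
        unfolding mom(2) using N by (intro mult_left_mono divide_left_mono) auto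
      show "0 < r" using \<mu> r by linarith
      have "\<delta> \<le> r / N" using r N by (simp add: \<delta>_def divide_right_mono)
      then show "norm (z - c) \<le> r / N" using z by linarith
      have "N\<^sup>2 = \<alpha>1 * \<mu>\<^sup>2 * (N - 1)" using \<mu> N by (simp add: \<alpha>1_def)
      also have "\<dots> \<le> \<alpha> * r\<^sup>2 * (N - 1)"
        using \<alpha> \<alpha>1 r \<mu> N by (intro mult_right_mono mult_mono power_mono) auto
      finally show "N\<^sup>2 \<le> \<alpha> * r\<^sup>2 * (N - 1)" .
    qed
    then show "real (card (shell L c r)) * exp (- \<alpha> * r\<^sup>2) \<le> (\<Sum>x\<in>shell L c r. exp (- \<alpha> * (norm (x - z))\<^sup>2))"
      by simp
  qed

  have near: "gaussian_sum L \<alpha> c \<le> gaussian_sum L \<alpha> z"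
    if \<alpha>: "\<alpha>1 \<le> \<alpha>" and d: "deep_hole L d" "norm (z - d) < \<delta>" for \<alpha> z d
  proof -
    obtain f where f: "affine_isometry f" "f ` L = L" "f c = d" using assms(3)[OF d(1)] by blast
    obtain T b where T: "orthogonal_transformation T" "f = (\<lambda>x. T x + b)"
      using f(1) unfolding affine_isometry_def by blast
    \<comment> \<open>The point \<open>w\<close> is the preimage of \<open>z\<close> under the
      isometry taking \<open>c\<close> to \<open>d\<close>; it is as close to \<open>c\<close> as
      \<open>z\<close> is to \<open>d\<close>.\<close>
    obtain w where w: "T w = z - b"
      using orthogonal_transformation_surj[OF T(1)] by (metis surjD)
    have "z - d = T (w - c)"
      using w f(3)[symmetric] by (simp add: T(2) linear_diff[OF orthogonal_transformation_linear[OF T(1)]])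
    then have "norm (w - c) < \<delta>"
      using d(2) by (simp add: orthogonal_transformation_norm[OF T(1)])
    from near_c[OF \<alpha> this] have "gaussian_sum L \<alpha> c \<le> gaussian_sum L \<alpha> (f w)"
      by (simp add: gaussian_sum_affine_isometry[OF f(1,2)])
    then show ?thesis using w by (simp add: T(2))
  qed

  obtain R where R: "\<And>z. \<exists>l\<in>L. norm (z - l) \<le> R"
    using full_lattice_cobounded[OF lat] by metis
  \<comment> \<open>Every point has a lattice translate in \<open>cball 0 R\<close>. Removing the
    open \<open>\<delta>\<close>-balls around all deep holes leaves a compact set, however many deep
    holes there are.\<close>
  define K where "K = cball 0 R \<inter> (\<Inter>d\<in>Collect (deep_hole L). {z. \<delta> \<le> norm (z - d)})"
  have "compact K"
    unfolding K_def by (intro compact_Int_closed compact_cball closed_INT ballI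
        closed_Collect_le continuous_intros)
  \<comment> \<open>On \<open>K\<close> the maximal distance is attained and differs from
    \<open>\<mu>\<close>, as otherwise the maximizer would be a deep hole in \<open>K\<close>. The
    value \<open>m\<close> is put strictly in between to serve the strict hypothesis of the lower
    bound; \<open>0 \<le> m\<close> is needed to compare squares.\<close>
  obtain m where m: "0 \<le> m" "m < \<mu>" "\<And>z. z \<in> K \<Longrightarrow> infdist z L < m"
  proof (cases "K = {}")
    case True
    then show ?thesis using that[of 0] \<mu> by simp
  next
    case False
    have "continuous_on K (\<lambda>z. infdist z L)" by (intro continuous_intros)
    then obtain p where p: "p \<in> K" "\<And>z. z \<in> K \<Longrightarrow> infdist z L \<le> infdist p L"
      using continuous_attains_sup[OF \<open>compact K\<close> False] by blast
    have "infdist p L \<noteq> \<mu>"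
    proof
      assume "infdist p L = \<mu>"
      then have "deep_hole L p" using \<mu>_max by (simp add: deep_hole_def)
      then show False using p(1) \<delta> by (auto simp: K_def)
    qed
    then have "infdist p L < \<mu>" using \<mu>_max[of p] by simp
    then obtain m where "infdist p L < m" "m < \<mu>" using dense by blast
    with p(2) infdist_nonneg[of p L] that[of m] show ?thesis by fastforce
  qed

  \<comment> \<open>With this \<open>C\<close> the upper bound at \<open>c\<close> reads
    \<open>exp (- \<alpha> * \<mu>\<^sup>2) * C\<close>.\<close>
  define C where "C = exp (\<mu>\<^sup>2) * gaussian_sum L 1 c"
  have C: "0 \<le> C" by (simp add: C_def gaussian_sum_def infsum_nonneg)
  \<comment> \<open>From \<open>\<alpha>2\<close> on,
    \<open>C \<le> \<alpha> * (\<mu>\<^sup>2 - m\<^sup>2)\<close>, which is below its exponential,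
    the ratio of \<open>exp (- \<alpha> * m\<^sup>2)\<close> to
    \<open>exp (- \<alpha> * \<mu>\<^sup>2)\<close>.\<close>
  define \<alpha>2 where "\<alpha>2 = C / (\<mu>\<^sup>2 - m\<^sup>2)"
  have gap: "0 < \<mu>\<^sup>2 - m\<^sup>2" using m by (simp add: power_strict_mono)
  have far: "gaussian_sum L \<alpha> c \<le> gaussian_sum L \<alpha> z" if \<alpha>: "1 \<le> \<alpha>" "\<alpha>2 \<le> \<alpha>" and z: "z \<in> K" for \<alpha> z
  proof -
    have "C \<le> \<alpha> * (\<mu>\<^sup>2 - m\<^sup>2)" using \<alpha> gap by (simp add: \<alpha>2_def pos_divide_le_eq)
    also have "\<dots> \<le> exp (\<alpha> * (\<mu>\<^sup>2 - m\<^sup>2))"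
      by (meson exp_ge_add_one_self less_add_same_cancel2 less_le_not_le less_le_trans linear zero_less_one order_trans)
    finally have "exp (- \<alpha> * \<mu>\<^sup>2) * C \<le> exp (- \<alpha> * \<mu>\<^sup>2) * exp (\<alpha> * (\<mu>\<^sup>2 - m\<^sup>2))"
      by (intro mult_left_mono) auto
    also have "\<dots> = exp (- \<alpha> * m\<^sup>2)"
      by (simp add: algebra_simps flip: exp_add)
    also have "exp (- \<alpha> * \<mu>\<^sup>2) * C = exp (- (\<alpha> - 1) * \<mu>\<^sup>2) * gaussian_sum L 1 c"
      by (simp add: C_def algebra_simps mult_exp_exp)
    finally have "exp (- (\<alpha> - 1) * \<mu>\<^sup>2) * gaussian_sum L 1 c \<le> exp (- \<alpha> * m\<^sup>2)" .
    with gaussian_sum_upper_bound[OF lat \<alpha>(1), of c] gaussian_sum_lower_bound[OF lat _ m(3)[OF z], of \<alpha>] \<alpha>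
    show ?thesis by (simp add: \<mu>_def)
  qed

  show ?thesis
    unfolding stable_cold_spot_def
  proof (intro exI[of _ "max 1 (max \<alpha>1 \<alpha>2)"] allI impI)
    fix \<alpha> z assume "max 1 (max \<alpha>1 \<alpha>2) \<le> \<alpha>"
    then have \<alpha>: "1 \<le> \<alpha>" "\<alpha>1 \<le> \<alpha>" "\<alpha>2 \<le> \<alpha>" by auto
    \<comment> \<open>The Gaussian sum is periodic under \<open>L\<close>, so \<open>z\<close> may
      be replaced by \<open>z - l\<close> in \<open>cball 0 R\<close>, which lies in
      \<open>K\<close> or near a deep hole.\<close>
    obtain l where l: "l \<in> L" "norm (z - l) \<le> R" using R by blast
    have "gaussian_sum L \<alpha> c \<le> gaussian_sum L \<alpha> (z - l)"
    proof (cases "z - l \<in> K")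
      case True
      then show ?thesis using far \<alpha> by blast
    next
      case False
      then obtain d where "deep_hole L d" "norm (z - l - d) < \<delta>"
        using l(2) by (auto simp: K_def not_le)
      then show ?thesis using near \<alpha> by blast
    qed
    also have "gaussian_sum L \<alpha> (z - l) = gaussian_sum L \<alpha> z"
    proof (rule gaussian_sum_affine_isometry[OF _ full_lattice_image_translation[OF lat l(1)]])
      show "affine_isometry (\<lambda>x. x - l)"
        unfolding affine_isometry_def
        by (intro exI[of _ id] exI[of _ "- l"]) (auto simp: orthogonal_transformation_def linear_id)
    qed
    finally show "gaussian_sum L \<alpha> c \<le> gaussian_sum L \<alpha> z" .
  qed
qed

end
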